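(* For every Perron number $\alpha$, there exists a primitive random substitution $\vartheta$ on a finite alphabet whose associated RS-subshift $X_\vartheta$ is topologically mixing and whose topological entropy is given by $h_{\mathrm{top}}(X_\vartheta)=\log(\alpha)$.
   Context: A Perron number is a real algebraic integer $\alpha\ge1$ such that all other algebraic conjugates of $\alpha$ are strictly smaller in absolute value than $|\alpha|$. For a finite alphabet $\mathcal A$, $\mathcal A^+$ is the set of non-empty finite words over $\mathcal A$, and $\mathcal S(\mathcal A^+)$ is the set of all non-empty finite subsets of $\mathcal A^+$. A random substitution on $\mathcal A$ is a map $\vartheta\colon\mathcal A\to\mathcal S(\mathcal A^+)$ (no probabilities are recorded). It extends to words by $\vartheta(a_1\cdots a_m)=\{u_1\cdots u_m : u_i\in\vartheta(a_i)\}$ and to finite non-empty sets of words by $\vartheta(B)=\bigcup_{u\in B}\vartheta(u)$; powers $\vartheta^k$ are defined by iterated composition, with $\vartheta^0(a)=\{a\}$. The language $\mathcal L_\vartheta$ is the set of all words $u$ that are (contiguous) subwords of some element of $\vartheta^k(a)$ for some $k\ge0$ and $a\in\mathcal A$. The RS-subshift is $X_\vartheta=\{w\in\mathcal A^{\mathbb Z} : \text{every finite subword of } w \text{ lies in } \mathcal L_\vartheta\}$, with the shift action. The random substitution $\vartheta$ is primitive if there is $k\in\mathbb N$ such that for all $a,b\in\mathcal A$ the letter $a$ occurs in some element of $\vartheta^k(b)$. For a non-empty subshift $X$, $h_{\mathrm{top}}(X)=\lim_{n\to\infty}\frac1n\log|\mathcal L^n(X)|$, where $\mathcal L^n(X)$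 is the set of words of length $n$ occurring in elements of $X$. *)

theory Defs
  imports
    "HOL-Analysis.Analysis"
    "HOL-Computational_Algebra.Computational_Algebra"
    "HOL-Library.Sublist"
begin

section \<open>Perron numbers\<close>

text \<open>The conjugates of an algebraic number are the complex roots of its minimal polynomial
  over the rationals.\<close>

definition min_rat_poly :: "complex \<Rightarrow> rat poly \<Rightarrow> bool" where
  "min_rat_poly x p \<longleftrightarrow> lead_coeff p = 1 \<and> irreducible p \<and> poly (map_poly of_rat p) x = 0"

definition conjugates :: "complex \<Rightarrow> complex set" where
  "conjugates x = {z. \<exists>p. min_rat_poly x p \<and> poly (map_poly of_rat p) z = 0}"

definition perron_number :: "real \<Rightarrow> bool" where
  "perron_number \<alpha> \<longleftrightarrow> algebraic_int \<alpha> \<and> 1 \<le> \<alpha> \<and>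
     (\<forall>z \<in> conjugates (of_real \<alpha>) - {of_real \<alpha>}. cmod z < \<bar>\<alpha>\<bar>)"


section \<open>Random substitutions\<close>

text \<open>The alphabet is an explicit finite set, so that its size may be quantified over; the values
  of a random substitution outside of the alphabet are irrelevant.\<close>

definition random_substitution :: "'a set \<Rightarrow> ('a \<Rightarrow> 'a list set) \<Rightarrow> bool" where
  "random_substitution A \<theta> \<longleftrightarrow> finite A \<and>
     (\<forall>a\<in>A. \<theta> a \<noteq> {} \<and> finite (\<theta> a) \<and> \<theta> a \<subseteq> lists A - {[]})"

definition subst_word :: "('a \<Rightarrow> 'a list set) \<Rightarrow> 'a list \<Rightarrow> 'a list set" where
  "subst_word \<theta> w = {concat us | us. list_all2 (\<lambda>u a. u \<in> \<theta> a) us w}"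

definition subst_set :: "('a \<Rightarrow> 'a list set) \<Rightarrow> 'a list set \<Rightarrow> 'a list set" where
  "subst_set \<theta> B = (\<Union>w\<in>B. subst_word \<theta> w)"

definition subst_power :: "('a \<Rightarrow> 'a list set) \<Rightarrow> nat \<Rightarrow> 'a \<Rightarrow> 'a list set" where
  "subst_power \<theta> k a = (subst_set \<theta> ^^ k) {[a]}"

definition primitive_subst :: "'a set \<Rightarrow> ('a \<Rightarrow> 'a list set) \<Rightarrow> bool" where
  "primitive_subst A \<theta> \<longleftrightarrow> (\<exists>k. \<forall>a\<in>A. \<forall>b\<in>A. \<exists>v\<in>subst_power \<theta> k b. a \<in> set v)"

definition subst_language :: "'a set \<Rightarrow> ('a \<Rightarrow> 'a list set) \<Rightarrow> 'a list set" where
  "subst_language A \<theta> = {u. \<exists>k. \<exists>a\<in>A. \<exists>v\<in>subst_power \<theta> k a. sublist u v}"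


section \<open>Subshifts\<close>

definition subword_at :: "(int \<Rightarrow> 'a) \<Rightarrow> int \<Rightarrow> nat \<Rightarrow> 'a list" where
  "subword_at w i n = map (\<lambda>j. w (i + int j)) [0..<n]"

definition rs_subshift :: "'a set \<Rightarrow> ('a \<Rightarrow> 'a list set) \<Rightarrow> (int \<Rightarrow> 'a) set" where
  "rs_subshift A \<theta> = {w. range w \<subseteq> A \<and> (\<forall>i n. subword_at w i n \<in> subst_language A \<theta>)}"

definition shift :: "(int \<Rightarrow> 'a) \<Rightarrow> int \<Rightarrow> 'a" where
  "shift w = (\<lambda>i. w (i + 1))"

definition full_shift_topology :: "'a set \<Rightarrow> (int \<Rightarrow> 'a) topology" where
  "full_shift_topology A = product_topology (\<lambda>_. discrete_topology A) UNIV"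

definition topologically_mixing :: "'x topology \<Rightarrow> ('x \<Rightarrow> 'x) \<Rightarrow> bool" where
  "topologically_mixing T f \<longleftrightarrow>
     (\<forall>U V. openin T U \<and> openin T V \<and> U \<noteq> {} \<and> V \<noteq> {} \<longrightarrow>
        (\<exists>N. \<forall>n\<ge>N. (f ^^ n) ` U \<inter> V \<noteq> {}))"

definition words_of_length :: "nat \<Rightarrow> (int \<Rightarrow> 'a) set \<Rightarrow> 'a list set" where
  "words_of_length n X = {subword_at w i n | w i. w \<in> X}"

text \<open>The limit exists, by subadditivity, for every non-empty subshift over a finite alphabet; for
  other sets of sequences the value is meaningless.\<close>

definition topological_entropy :: "(int \<Rightarrow> 'a) set \<Rightarrow> real" where
  "topological_entropy X = lim (\<lambda>n. ln (real (card (words_of_length n X))) / real n)"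

end

theory Submission
  imports Defs
begin

text \<open>
  The subshift is the vertex shift of a finite directed graph, that is, the set of its two-sided
  infinite paths. Two independent constructions are combined.

  \<^bold>\<open>From a graph to a random substitution.\<close> Let every two vertices of a finite graph be joined by
  walks of every sufficiently large length. A vertex \<open>a\<close> is sent to the set of all closed walks from
  \<open>a\<close> to \<open>a\<close> with at most one more vertex entry than there are vertices. Replacing an entry \<open>a\<close> of
  a walk by a closed walk at \<open>a\<close> changes neither its neighbours nor the end points, so only walks
  are produced. Conversely, a longer closed walk revisits some vertex \<open>v\<close> within a short distance,
  and collapsing that excursion to the single letter \<open>v\<close> undoes one application of the
  substitution; iterating leads to a single short closed walk. Every walk is contained in a closed
  walk, so the language consists of all walks (lemma \<open>subst_language_eq\<close>) and the RS-subshift is the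
  vertex shift, which is mixing because paths can be glued along walks of any prescribed large
  length. A positive vector \<open>r\<close> whose sum over the successors of each vertex \<open>a\<close> is \<open>\<alpha> * r a\<close> makes
  the number of walks of length \<open>n\<close> grow like \<open>\<alpha> ^ n\<close>, so the entropy is \<open>ln \<alpha>\<close>
  (lemma \<open>entropy_paths\<close>).

  \<^bold>\<open>From a Perron number to a graph\<close> (Lind's theorem). Let \<open>m\<close> be the minimal polynomial of \<open>\<alpha> > 1\<close>;
  it has integer coefficients and simple roots, and all roots other than \<open>\<alpha>\<close> are smaller in modulus.
  Elements of the ring generated by \<open>\<alpha>\<close> are represented by integer polynomials \<open>p\<close> of degree less than \<open>degree m\<close>.
  Consider those in the cone where \<open>p(\<alpha>)\<close> is positive and dominates the modulus of \<open>p\<close> at every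
  other root. Multiplication by \<open>\<alpha>\<close> moves the cone into a strictly narrower one. A large element of a
  narrower cone is a sum of cone elements of bounded size: divide it by an integer \<open>N\<close> and round the
  multiples \<open>k / N\<close> of its coefficients, \<open>k \<le> N\<close>; consecutive differences stay within a bounded
  distance of the exact quotient, hence in the cone (lemma \<open>cone_decomposition\<close>). As only finitely many cone elements have
  bounded size, this gives a finite set on which multiplication by \<open>\<alpha>\<close> is a substitution with
  positive eigenvector \<open>p(\<alpha>)\<close>. A fixed element \<open>z0\<close> close to the axis of the cone can be split off
  from every product that is too large, and from its own product \<open>\<alpha> * z0\<close>. So every element leads
  to \<open>z0\<close>, and \<open>z0\<close> leads to itself; the part reachable from \<open>z0\<close> is then strongly connected and
  aperiodic (lemma \<open>finite_successor_system\<close>).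
\<close>

section \<open>Substituting into words\<close>

lemma subst_word_Nil: "subst_word \<theta> [] = {[]}"
  by (auto simp: subst_word_def)

lemma subst_word_Cons:
  "subst_word \<theta> (a # w) = {u @ v | u v. u \<in> \<theta> a \<and> v \<in> subst_word \<theta> w}"
proof -
  have "x \<in> subst_word \<theta> (a # w) \<longleftrightarrow> x \<in> {u @ v | u v. u \<in> \<theta> a \<and> v \<in> subst_word \<theta> w}" for x
  proof
    assume "x \<in> subst_word \<theta> (a # w)"
    then obtain us where "list_all2 (\<lambda>u a. u \<in> \<theta> a) us (a # w)" "x = concat us"
      by (auto simp: subst_word_def)
    then obtain u us' where "u \<in> \<theta> a" "list_all2 (\<lambda>u a. u \<in> \<theta> a) us' w" "x = u @ concat us'"
      by (auto simp: list_all2_Cons2)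
    then show "x \<in> {u @ v | u v. u \<in> \<theta> a \<and> v \<in> subst_word \<theta> w}"
      by (auto simp: subst_word_def)
  next
    assume "x \<in> {u @ v | u v. u \<in> \<theta> a \<and> v \<in> subst_word \<theta> w}"
    then obtain u us where "u \<in> \<theta> a" "list_all2 (\<lambda>u a. u \<in> \<theta> a) us w" "x = u @ concat us"
      by (auto simp: subst_word_def)
    then have "list_all2 (\<lambda>u a. u \<in> \<theta> a) (u # us) (a # w)" "x = concat (u # us)" by auto
    then show "x \<in> subst_word \<theta> (a # w)" unfolding subst_word_def by blast
  qed
  then show ?thesis by blast
qed

lemma subst_word_append:
  "u \<in> subst_word \<theta> v \<Longrightarrow> u' \<in> subst_word \<theta> v' \<Longrightarrow> u @ u' \<in> subst_word \<theta> (v @ v')"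
proof (induction v arbitrary: u)
  case Nil
  then show ?case by (simp add: subst_word_Nil)
next
  case (Cons a v)
  then obtain x y where "x \<in> \<theta> a" "y \<in> subst_word \<theta> v" "u = x @ y"
    by (auto simp: subst_word_Cons)
  moreover from this Cons have "y @ u' \<in> subst_word \<theta> (v @ v')" by blast
  ultimately show ?case by (auto simp: subst_word_Cons)
qed

lemma subst_power_Suc: "subst_power \<theta> (Suc k) a = subst_set \<theta> (subst_power \<theta> k a)"
  by (simp add: subst_power_def)

lemma subst_power_1: "subst_power \<theta> 1 a = \<theta> a"
  by (simp add: subst_power_def subst_set_def subst_word_Cons subst_word_Nil)

section \<open>Closed walks as a random substitution\<close>

text \<open>The last assumption says that the adjacency matrix is primitive: walks of every sufficiently
  large length join every vertex to every vertex.\<close>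

locale mixing_graph =
  fixes V :: "'a set" and R :: "('a \<times> 'a) set"
  assumes fin: "finite V" and nonempty: "V \<noteq> {}"
    and edges: "R \<subseteq> V \<times> V"
    and mixing: "\<exists>N. \<forall>n\<ge>N. V \<times> V \<subseteq> R ^^ n"
begin

definition walk :: "'a list \<Rightarrow> bool" where
  "walk w \<longleftrightarrow> set w \<subseteq> V \<and> successively (\<lambda>a b. (a, b) \<in> R) w"

definition closed_walks :: "'a \<Rightarrow> 'a list set" where
  "closed_walks a = {w. walk w \<and> w \<noteq> [] \<and> hd w = a \<and> last w = a}"

text \<open>The length bound makes the images finite; it is large enough because among any \<open>card V + 1\<close>
  consecutive entries of a walk some vertex occurs twice.\<close>

definition loop_subst :: "'a \<Rightarrow> 'a list set" where
  "loop_subst a = {w \<in> closed_walks a. length w \<le> card V + 1}"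

lemma walk_Nil [simp]: "walk []"
  by (simp add: walk_def)

lemma walk_single [simp]: "walk [a] \<longleftrightarrow> a \<in> V"
  by (simp add: walk_def)

lemma walk_append_iff:
  "walk (u @ v) \<longleftrightarrow> walk u \<and> walk v \<and> (u = [] \<or> v = [] \<or> (last u, hd v) \<in> R)"
  by (auto simp: walk_def successively_append_iff)

lemma walk_sublist: "walk w \<Longrightarrow> sublist u w \<Longrightarrow> walk u"
  by (auto simp: sublist_def walk_append_iff)

lemma self_in_loop_subst: "a \<in> V \<Longrightarrow> [a] \<in> loop_subst a"
  by (auto simp: loop_subst_def closed_walks_def walk_def)

lemma subst_word_refl: "set w \<subseteq> V \<Longrightarrow> w \<in> subst_word loop_subst w"
proof (induction w)
  case Nil
  then show ?case by (simp add: subst_word_Nil)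
next
  case (Cons a w)
  then have "[a] \<in> loop_subst a" "w \<in> subst_word loop_subst w" by (auto intro: self_in_loop_subst)
  then have "[a] @ w \<in> subst_word loop_subst (a # w)" unfolding subst_word_Cons by blast
  then show ?case by simp
qed

text \<open>Each letter is replaced by a word with the same first and the same last letter, so the edges between
  consecutive letters remain the edges between consecutive blocks.\<close>

lemma subst_word_walk:
  "walk w \<Longrightarrow> u \<in> subst_word loop_subst w \<Longrightarrow>
     walk u \<and> (u = [] \<longleftrightarrow> w = []) \<and> (w \<noteq> [] \<longrightarrow> hd u = hd w \<and> last u = last w)"
proof (induction w arbitrary: u)
  case Nil
  then show ?case by (simp add: subst_word_Nil)
next
  case (Cons a w)
  from Cons.prems(1) have w: "walk w" "w \<noteq> [] \<Longrightarrow> (a, hd w) \<in> R"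
    using walk_append_iff[of "[a]" w] by auto
  from Cons.prems(2) obtain x y where x: "x \<in> loop_subst a" and y: "y \<in> subst_word loop_subst w"
    and u: "u = x @ y"
    by (auto simp: subst_word_Cons)
  from x have "walk x" "x \<noteq> []" "hd x = a" "last x = a"
    by (auto simp: loop_subst_def closed_walks_def)
  with Cons.IH[OF w(1) y] w u show ?case
    by (auto simp: walk_append_iff)
qed

lemma subst_power_closed_walks:
  assumes "a \<in> V" shows "subst_power loop_subst k a \<subseteq> closed_walks a"
proof (induction k)
  case 0
  show ?case using assms by (auto simp: subst_power_def closed_walks_def)
next
  case (Suc k)
  show ?case
  proof
    fix u assume "u \<in> subst_power loop_subst (Suc k) a"
    then obtain w where w: "w \<in> subst_power loop_subst k a" and u: "u \<in> subst_word loop_subst w"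
      by (auto simp: subst_power_Suc subst_set_def)
    from w Suc have "w \<in> closed_walks a" by blast
    with subst_word_walk[OF _ u] show "u \<in> closed_walks a" by (auto simp: closed_walks_def)
  qed
qed

text \<open>Since \<open>[a]\<close> is one of the images of \<open>a\<close>, letters may be left unchanged. This permits the same power
  to serve for all pairs of letters in the proof of primitivity.\<close>

lemma subst_power_mono:
  assumes "a \<in> V" "k \<le> l" shows "subst_power loop_subst k a \<subseteq> subst_power loop_subst l a"
  using assms(2)
proof (induction rule: dec_induct)
  case base
  show ?case by (rule subset_refl)
next
  case (step n)
  have "subst_power loop_subst n a \<subseteq> subst_power loop_subst (Suc n) a"
  proof
    fix u assume "u \<in> subst_power loop_subst n a"
    moreover from this have "u \<in> subst_word loop_subst u"
      using subst_power_closed_walks[OF assms(1), of n]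
      by (intro subst_word_refl) (auto simp: closed_walks_def walk_def)
    ultimately show "u \<in> subst_power loop_subst (Suc n) a"
      by (auto simp: subst_power_Suc subst_set_def)
  qed
  with step.IH show ?case by (rule subset_trans)
qed

text \<open>A closed walk that is too long to be an image of its base point contains a short excursion
  \<open>v \<dots> v\<close>. Collapsing the excursion to \<open>v\<close> gives a shorter closed walk with the same base point,
  from which the original one arises by substituting the excursion for \<open>v\<close> and leaving all other
  letters unchanged.\<close>

lemma closed_walk_generated:
  "w \<in> closed_walks a \<Longrightarrow> \<exists>k. w \<in> subst_power loop_subst k a"
proof (induction "length w" arbitrary: w rule: less_induct)
  case less
  show ?case
  proof (cases "length w \<le> card V + 1")
    case True
    with less.prems have "w \<in> subst_power loop_subst 1 a"
      unfolding subst_power_1 by (simp add: loop_subst_def)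
    then show ?thesis by blast
  next
    case False
    \<comment> \<open>Looking for a repetition in a prefix only keeps the excursion short.\<close>
    define t where "t = take (card V + 1) w"
    have lt: "length t = card V + 1" using False by (simp add: t_def)
    have w: "walk w" "w \<noteq> []" "hd w = a" "last w = a"
      using less.prems by (auto simp: closed_walks_def)
    have "set t \<subseteq> V" using w(1) by (auto simp: t_def walk_def dest: in_set_takeD)
    then have "card (set t) \<le> card V" using fin card_mono by blast
    with lt have "\<not> distinct t" using distinct_card[of t] by linarith
    then obtain xs ys zs v where t: "t = xs @ [v] @ ys @ [v] @ zs"
      using not_distinct_decomp[of t] by blast
    define zs' where "zs' = zs @ drop (card V + 1) w"
    have weq: "w = xs @ ([v] @ ys @ [v]) @ zs'"
      using append_take_drop_id[of "card V + 1" w, folded t_def] unfolding t zs'_def by simp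
    define w' where "w' = xs @ [v] @ zs'"
    have walks: "walk xs" "walk ([v] @ ys @ [v])" "walk zs'" "v \<in> V" "xs \<noteq> [] \<Longrightarrow> (last xs, v) \<in> R"
      "zs' \<noteq> [] \<Longrightarrow> (v, hd zs') \<in> R"
      using w(1) unfolding weq walk_append_iff by auto
    have "w' \<in> closed_walks a"
      using walks w(2-) unfolding closed_walks_def w'_def weq
      by (auto simp: walk_append_iff hd_append simp del: append_Cons split: if_splits)
    moreover have "length w' < length w" by (simp add: w'_def weq)
    ultimately obtain k where k: "w' \<in> subst_power loop_subst k a"
      using less.hyps by blast
    have "[v] @ ys @ [v] \<in> loop_subst v"
      using walks lt unfolding loop_subst_def closed_walks_def by (simp add: t)
    then have "[v] @ ys @ [v] \<in> subst_word loop_subst [v]"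
      by (simp add: subst_word_Cons subst_word_Nil)
    moreover have "xs \<in> subst_word loop_subst xs" "zs' \<in> subst_word loop_subst zs'"
      using walks by (auto intro!: subst_word_refl simp: walk_def)
    ultimately have "w \<in> subst_word loop_subst w'"
      unfolding weq w'_def by (intro subst_word_append)
    with k have "w \<in> subst_power loop_subst (Suc k) a"
      by (auto simp: subst_power_Suc subst_set_def)
    then show ?thesis by blast
  qed
qed

lemma edge_in_V: "(a, b) \<in> R \<Longrightarrow> a \<in> V \<and> b \<in> V"
  using edges by auto

lemma relpow_walk:
  "(a, b) \<in> R ^^ Suc n \<Longrightarrow> \<exists>w. walk w \<and> w \<noteq> [] \<and> (a, hd w) \<in> R \<and> last w = b"
proof (induction n arbitrary: a)
  case 0
  then show ?case by (intro exI[of _ "[b]"]) (auto dest: edge_in_V)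
next
  case (Suc n)
  from relpow_Suc_D2[OF Suc.prems] obtain c where c: "(a, c) \<in> R" "(c, b) \<in> R ^^ Suc n" by blast
  from Suc.IH[OF c(2)] obtain w where "walk w" "w \<noteq> []" "(c, hd w) \<in> R" "last w = b" by blast
  with c show ?case
    by (intro exI[of _ "[c] @ w"]) (auto simp: walk_append_iff dest: edge_in_V simp del: append_Cons)
qed

lemma connecting_walk:
  assumes "a \<in> V" "b \<in> V"
  obtains w where "walk w" "w \<noteq> []" "(a, hd w) \<in> R" "last w = b"
proof -
  from mixing obtain N where "\<forall>n\<ge>N. V \<times> V \<subseteq> R ^^ n" by blast
  then have "(a, b) \<in> R ^^ Suc N" using assms by (meson SigmaI le_SucI order_refl subsetD)
  from relpow_walk[OF this] that show thesis by blast
qed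

lemma subst_language_eq: "subst_language V loop_subst = {w. walk w}"
proof (intro subset_antisym subsetI)
  fix u assume "u \<in> subst_language V loop_subst"
  then obtain k a v where "a \<in> V" "v \<in> subst_power loop_subst k a" "sublist u v"
    by (auto simp: subst_language_def)
  then show "u \<in> {w. walk w}"
    using subst_power_closed_walks[of a k] walk_sublist by (auto simp: closed_walks_def)
next
  fix u assume "u \<in> {w. walk w}"
  then have u: "walk u" by simp
  show "u \<in> subst_language V loop_subst"
  proof (cases "u = []")
    case True
    from nonempty obtain a where a: "a \<in> V" by blast
    have "[a] \<in> subst_power loop_subst 0 a" by (simp add: subst_power_def)
    with a True show ?thesis unfolding subst_language_def by blast
  next
    case False
    with u have V: "last u \<in> V" "hd u \<in> V"
      by (auto simp: walk_def)
    then obtain w where w: "walk w" "w \<noteq> []" "(last u, hd w) \<in> R" "last w = hd u"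
      by (rule connecting_walk)
    with u False have "u @ w \<in> closed_walks (hd u)"
      by (auto simp: closed_walks_def walk_append_iff)
    with closed_walk_generated obtain k where "u @ w \<in> subst_power loop_subst k (hd u)" by blast
    with V show ?thesis unfolding subst_language_def by blast
  qed
qed

lemma random_substitution_loop_subst: "random_substitution V loop_subst"
  unfolding random_substitution_def
proof (intro conjI ballI)
  fix a assume a: "a \<in> V"
  show "loop_subst a \<noteq> {}" using self_in_loop_subst[OF a] by blast
  have "loop_subst a \<subseteq> {w. set w \<subseteq> V \<and> length w \<le> card V + 1}"
    by (auto simp: loop_subst_def closed_walks_def walk_def)
  then show "finite (loop_subst a)"
    using finite_lists_length_le[OF fin] finite_subset by blast
  show "loop_subst a \<subseteq> lists V - {[]}"
    by (auto simp: loop_subst_def closed_walks_def walk_def)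
qed (rule fin)

text \<open>A closed walk at \<open>b\<close> can be routed through any vertex \<open>a\<close>.\<close>

lemma primitive_loop_subst: "primitive_subst V loop_subst"
proof -
  have "\<exists>k. \<exists>v\<in>subst_power loop_subst k b. a \<in> set v" if ab: "a \<in> V" "b \<in> V" for a b
  proof -
    obtain u where u: "walk u" "u \<noteq> []" "(b, hd u) \<in> R" "last u = a"
      using ab connecting_walk by blast
    obtain v where v: "walk v" "v \<noteq> []" "(a, hd v) \<in> R" "last v = b"
      using ab connecting_walk by blast
    have "[b] @ u @ v \<in> closed_walks b"
      using u v ab unfolding closed_walks_def
      by (auto simp: walk_append_iff simp del: append_Cons)
    moreover have "a \<in> set ([b] @ u @ v)" using u by auto
    ultimately show ?thesis using closed_walk_generated by blast
  qed
  then obtain k where k: "\<And>a b. a \<in> V \<Longrightarrow> b \<in> V \<Longrightarrow> \<exists>v\<in>subst_power loop_subst (k a b) b. a \<in> set v"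
    by metis
  define K where "K = Max ((\<lambda>(a, b). k a b) ` (V \<times> V))"
  have "k a b \<le> K" if "a \<in> V" "b \<in> V" for a b
    unfolding K_def using that fin by (intro Max_ge) auto
  then show ?thesis
    unfolding primitive_subst_def using k subst_power_mono by blast
qed

section \<open>The vertex shift\<close>

definition paths :: "(int \<Rightarrow> 'a) set" where
  "paths = {x. \<forall>i. (x i, x (i + 1)) \<in> R}"

lemma path_in_V: "x \<in> paths \<Longrightarrow> x i \<in> V"
  using edge_in_V by (auto simp: paths_def)

lemma walk_subword_at: "x \<in> paths \<Longrightarrow> walk (subword_at x i n)"
proof (induction n)
  case (Suc n)
  have eq: "subword_at x i (Suc n) = subword_at x i n @ [x (i + int n)]"
    by (simp add: subword_at_def)
  have "(last (subword_at x i n), x (i + int n)) \<in> R" if ne: "subword_at x i n \<noteq> []"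
  proof -
    from ne obtain m where m: "n = Suc m" by (cases n) (auto simp: subword_at_def)
    then have "last (subword_at x i n) = x (i + int m)" by (simp add: subword_at_def)
    moreover have "i + int n = i + int m + 1" using m by simp
    moreover have "(x (i + int m), x (i + int m + 1)) \<in> R" using Suc.prems unfolding paths_def by blast
    ultimately show ?thesis by metis
  qed
  with Suc path_in_V show ?case unfolding eq walk_append_iff by auto
qed (simp add: subword_at_def)

text \<open>Whether all finite subwords are walks can be tested on the subwords of length two.\<close>

lemma rs_subshift_eq: "rs_subshift V loop_subst = paths"
proof (intro subset_antisym subsetI)
  fix x assume "x \<in> rs_subshift V loop_subst"
  then have "walk (subword_at x i 2)" for i
    by (auto simp: rs_subshift_def subst_language_eq)
  then have "(x i, x (i + 1)) \<in> R" for i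
    by (auto simp: subword_at_def walk_def numeral_2_eq_2 dest: spec[of _ i])
  then show "x \<in> paths" by (simp add: paths_def)
next
  fix x assume "x \<in> paths"
  then show "x \<in> rs_subshift V loop_subst"
    using walk_subword_at path_in_V by (auto simp: rs_subshift_def subst_language_eq)
qed

text \<open>Any closed walk at \<open>a\<close> can be repeated periodically.\<close>

lemma path_through:
  assumes "a \<in> V" obtains x where "x \<in> paths" "x 0 = a"
proof -
  from mixing obtain N where "\<forall>n\<ge>N. V \<times> V \<subseteq> R ^^ n" by blast
  then have "(a, a) \<in> R ^^ Suc N" using assms by (meson SigmaI le_SucI order_refl subsetD)
  then obtain f where f: "f 0 = a" "f (Suc N) = a" "\<And>i. i < Suc N \<Longrightarrow> (f i, f (Suc i)) \<in> R"
    unfolding relpow_fun_conv by blast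
  define x where "x i = f (nat (i mod int (Suc N)))" for i
  have "(x i, x (i + 1)) \<in> R" for i
  proof -
    define j where "j = nat (i mod int (Suc N))"
    have j: "int j = i mod int (Suc N)" "j < Suc N"
      by (simp_all add: j_def nat_less_iff)
    have mod: "(i + 1) mod int (Suc N) = (int j + 1) mod int (Suc N)"
      unfolding j by presburger
    have "x (i + 1) = f (Suc j)"
    proof (cases "j = N")
      case True
      then have "int j + 1 = int (Suc N)" by simp
      then have "(i + 1) mod int (Suc N) = 0" unfolding mod by (simp only: mod_self)
      with True f show ?thesis by (simp add: x_def)
    next
      case False
      with j have "(i + 1) mod int (Suc N) = int j + 1"
        unfolding mod by (intro mod_pos_pos_trivial) auto
      then show ?thesis by (simp add: x_def nat_add_distrib)
    qed
    moreover have "x i = f j" by (simp add: x_def j_def)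
    ultimately show ?thesis using f(3)[OF j(2)] by simp
  qed
  then have "x \<in> paths" by (simp add: paths_def)
  moreover have "x 0 = a" by (simp add: x_def f)
  ultimately show thesis by (rule that)
qed

text \<open>The past of \<open>x\<close> up to time \<open>p\<close>, followed by a walk of exactly \<open>k\<close> steps, followed by the future of \<open>y\<close>
  from time \<open>q\<close> on. The control over \<open>k\<close> gives topological mixing; the case \<open>k = 1\<close> extends walks.\<close>

lemma glue_paths:
  assumes x: "x \<in> paths" and y: "y \<in> paths" and k: "(x p, y q) \<in> R ^^ k"
  obtains z where "z \<in> paths" "\<And>i. i \<le> p \<Longrightarrow> z i = x i"
    "\<And>i. i \<ge> p + int k \<Longrightarrow> z i = y (i - (p + int k) + q)"
proof -
  from k obtain f where f: "f 0 = x p" "f k = y q" "\<And>i. i < k \<Longrightarrow> (f i, f (Suc i)) \<in> R"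
    unfolding relpow_fun_conv by blast
  define z where "z i = (if i \<le> p then x i else if i < p + int k then f (nat (i - p))
    else y (i - (p + int k) + q))" for i
  have zf: "z (p + int j) = f j" if "j \<le> k" for j
    using that f by (cases "j = k"; cases "j = 0") (auto simp: z_def)
  have zy: "z i = y (i - (p + int k) + q)" if "i \<ge> p + int k" for i
    using that f by (cases "k = 0"; cases "i = p") (auto simp: z_def)
  have "(z i, z (i + 1)) \<in> R" for i
  proof -
    consider "i < p" | j where "i = p + int j" "j < k" | "i \<ge> p + int k"
    proof -
      assume 1: "i < p \<Longrightarrow> thesis" and 2: "\<And>j. i = p + int j \<Longrightarrow> j < k \<Longrightarrow> thesis"
        and 3: "p + int k \<le> i \<Longrightarrow> thesis"
      have "i = p + int (nat (i - p))" if "p \<le> i" using that by simp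
      then show thesis using 1 2[of "nat (i - p)"] 3 by linarith
    qed
    then show ?thesis
    proof cases
      case 1
      then show ?thesis using x by (simp add: z_def paths_def)
    next
      case 2
      then have "z i = f j" "z (i + 1) = f (Suc j)"
        using zf[of j] zf[of "Suc j"] by (simp_all add: algebra_simps)
      then show ?thesis using f(3) 2 by simp
    next
      case 3
      have "(y (i - (p + int k) + q), y (i - (p + int k) + q + 1)) \<in> R" 
        using y unfolding paths_def by blast
      moreover have "i - (p + int k) + q + 1 = i + 1 - (p + int k) + q" by simp
      ultimately show ?thesis using zy[of i] zy[of "i + 1"] 3 by (simp del: of_nat_add)
    qed
  qed
  then have "z \<in> paths" by (simp add: paths_def)
  then show thesis using zy by (intro that[of z]) (auto simp: z_def)
qed

lemma walk_extends:
  assumes "walk w" shows "\<exists>x\<in>paths. subword_at x 0 (length w) = w"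
  using assms
proof (induction w rule: rev_induct)
  case Nil
  from nonempty path_through show ?case by (auto simp: subword_at_def)
next
  case (snoc b w)
  then have b: "b \<in> V" "walk w" "w = [] \<or> (last w, b) \<in> R" by (auto simp: walk_append_iff)
  then obtain y where y: "y \<in> paths" "y 0 = b" using path_through by blast
  show ?case
  proof (cases "w = []")
    case True
    with y show ?thesis by (auto simp: subword_at_def)
  next
    case False
    from snoc.IH b obtain x where x: "x \<in> paths" "subword_at x 0 (length w) = w" by blast
    have nth: "x (int i) = w ! i" if "i < length w" for i
      using that arg_cong[OF x(2), of "\<lambda>u. u ! i"] by (simp add: subword_at_def)
    define p where "p = int (length w - 1)"
    have "x p = last w" using nth[of "length w - 1"] False by (simp add: p_def last_conv_nth)
    then have "(x p, y 0) \<in> R ^^ 1" using b False y by simp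
    from glue_paths[OF x(1) y(1) this] obtain z where z: "z \<in> paths" "\<And>i. i \<le> p \<Longrightarrow> z i = x i"
      "\<And>i. i \<ge> p + 1 \<Longrightarrow> z i = y (i - (p + 1))" by auto
    have p: "p + 1 = int (length w)" using False by (simp add: p_def of_nat_diff Suc_leI)
    have "z (int (length w)) = b" using z(3)[of "p + 1"] p y by simp
    moreover have "map (\<lambda>j. z (int j)) [0..<length w] = w"
      using z(2) nth p by (intro nth_equalityI) auto
    ultimately have "subword_at z 0 (length (w @ [b])) = w @ [b]" by (simp add: subword_at_def)
    with z(1) show ?thesis by blast
  qed
qed

lemma words_of_length_paths: "words_of_length n paths = {w. walk w \<and> length w = n}"
proof (intro subset_antisym subsetI)
  fix w assume "w \<in> words_of_length n paths"
  then show "w \<in> {w. walk w \<and> length w = n}"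
    using walk_subword_at by (auto simp: words_of_length_def) (simp add: subword_at_def)
next
  fix w assume "w \<in> {w. walk w \<and> length w = n}"
  then have w: "walk w" "length w = n" by auto
  from walk_extends[OF w(1)] obtain x where "x \<in> paths" "subword_at x 0 (length w) = w" by blast
  with w(2) have "x \<in> paths" "w = subword_at x 0 n" by simp_all
  then show "w \<in> words_of_length n paths"
    unfolding words_of_length_def by blast
qed

lemma shift_iter: "(shift ^^ n) x = (\<lambda>i. x (i + int n))"
  by (induction n) (auto simp: shift_def algebra_simps)

text \<open>A basic open set of the product topology constrains only finitely many coordinates, so membership in
  an open set is decided by a finite central window.\<close>

lemma open_window:
  assumes "openin (subtopology (full_shift_topology V) paths) U" and "x \<in> U"
  shows "x \<in> paths \<and> (\<exists>m::nat. \<forall>y\<in>paths. (\<forall>i. \<bar>i\<bar> \<le> int m \<longrightarrow> y i = x i) \<longrightarrow> y \<in> U)"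
proof -
  from assms(1) obtain T where T: "openin (full_shift_topology V) T" "U = T \<inter> paths"
    by (auto simp: openin_subtopology)
  from T assms(2) obtain W :: "int \<Rightarrow> 'a set" where
    W: "finite {i. W i \<noteq> V}" "x \<in> Pi\<^sub>E UNIV W" "Pi\<^sub>E UNIV W \<subseteq> T"
    unfolding full_shift_topology_def openin_product_topology_alt by (auto 0 3)
  define m where "m = nat (Max (insert 0 (abs ` {i. W i \<noteq> V})))"
  have m: "\<bar>i\<bar> \<le> int m" if "W i \<noteq> V" for i
  proof -
    have "\<bar>i\<bar> \<le> Max (insert 0 (abs ` {i. W i \<noteq> V}))" using W(1) that by (intro Max_ge) auto
    then show ?thesis unfolding m_def by linarith
  qed
  have "y \<in> U" if y: "y \<in> paths" "\<forall>i. \<bar>i\<bar> \<le> int m \<longrightarrow> y i = x i" for y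
  proof -
    have "y i \<in> W i" for i
    proof (cases "W i = V")
      case True
      then show ?thesis using path_in_V y(1) by blast
    next
      case False
      then show ?thesis using m y(2) W(2) by (auto simp: PiE_iff)
    qed
    then have "y \<in> Pi\<^sub>E UNIV W" by auto
    then show ?thesis using W(3) T(2) y(1) by blast
  qed
  moreover have "x \<in> paths" using assms(2) T(2) by blast
  ultimately show ?thesis by blast
qed

lemma paths_topologically_mixing:
  "topologically_mixing (subtopology (full_shift_topology V) paths) shift"
  unfolding topologically_mixing_def
proof (intro allI impI, elim conjE)
  fix U U' assume U: "openin (subtopology (full_shift_topology V) paths) U" "U \<noteq> {}"
    and U': "openin (subtopology (full_shift_topology V) paths) U'" "U' \<noteq> {}"
  from U(2) U'(2) obtain x y where mem: "x \<in> U" "y \<in> U'" by blast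
  from open_window[OF U(1) mem(1)] obtain m where x: "x \<in> paths"
    "\<forall>z\<in>paths. (\<forall>i. \<bar>i\<bar> \<le> int m \<longrightarrow> z i = x i) \<longrightarrow> z \<in> U" by blast
  from open_window[OF U'(1) mem(2)] obtain l where y: "y \<in> paths"
    "\<forall>z\<in>paths. (\<forall>i. \<bar>i\<bar> \<le> int l \<longrightarrow> z i = y i) \<longrightarrow> z \<in> U'" by blast
  from mixing obtain N where N: "\<And>n. n \<ge> N \<Longrightarrow> V \<times> V \<subseteq> R ^^ n" by blast
  show "\<exists>N. \<forall>n\<ge>N. (shift ^^ n) ` U \<inter> U' \<noteq> {}"
  proof (intro exI allI impI)
    fix n assume n: "n \<ge> N + m + l"
    define k where "k = n - m - l"
    have "(x (int m), y (- int l)) \<in> R ^^ k"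
    proof -
      have "N \<le> k" using n by (simp add: k_def)
      moreover have "(x (int m), y (- int l)) \<in> V \<times> V" using path_in_V x(1) y(1) by blast
      ultimately show ?thesis using N by blast
    qed
    from glue_paths[OF x(1) y(1) this] obtain z where z: "z \<in> paths"
      "\<And>i. i \<le> int m \<Longrightarrow> z i = x i"
      "\<And>i. i \<ge> int m + int k \<Longrightarrow> z i = y (i - (int m + int k) + - int l)" by metis
    have k: "int n = int m + int k + int l" using n by (simp add: k_def)
    have "z \<in> U" using z(1,2) x(2) by simp
    moreover have "(shift ^^ n) z \<in> U'"
    proof -
      have "(z (i + int n), z (i + int n + 1)) \<in> R" for i
        using z(1) unfolding paths_def by blast
      then have "(shift ^^ n) z \<in> paths"
        unfolding shift_iter paths_def by (simp add: algebra_simps)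
      moreover have "(shift ^^ n) z i = y i" if "\<bar>i\<bar> \<le> int l" for i
        unfolding shift_iter using that z(3)[of "i + int n"] k by simp
      ultimately show ?thesis using y(2) by simp
    qed
    ultimately show "(shift ^^ n) ` U \<inter> U' \<noteq> {}" by blast
  qed
qed

section \<open>Entropy from a positive eigenvector\<close>

text \<open>The walks of length \<open>n + 2\<close> are the one-step prolongations of those of length \<open>n + 1\<close>, and by the
  eigenvector equation prolonging a walk in all ways multiplies its weight by \<open>\<alpha>\<close>.\<close>

lemma eigenvector_sum_walks:
  fixes r :: "'a \<Rightarrow> real"
  assumes "\<And>a. a \<in> V \<Longrightarrow> (\<Sum>b\<in>R `` {a}. r b) = \<alpha> * r a"
  shows "(\<Sum>w | walk w \<and> length w = Suc n. r (last w)) = \<alpha> ^ n * (\<Sum>a\<in>V. r a)"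
proof (induction n)
  case 0
  have "{w. walk w \<and> length w = Suc 0} = (\<lambda>a. [a]) ` V" by (auto simp: length_Suc_conv)
  then show ?case by (simp add: sum.reindex inj_on_def)
next
  case (Suc n)
  let ?W = "{w. walk w \<and> length w = Suc n}"
  have "?W \<subseteq> {w. set w \<subseteq> V \<and> length w = Suc n}" by (auto simp: walk_def)
  then have finW: "finite ?W" using finite_lists_length_eq[OF fin] finite_subset by blast
  have finR: "finite (R `` {a})" for a
    using edges fin by (rule_tac finite_subset[of _ V]) auto
  have bij: "{w. walk w \<and> length w = Suc (Suc n)} =
      (\<lambda>(w, b). w @ [b]) ` (SIGMA w:?W. R `` {last w})" (is "?L = ?R")
  proof (intro subset_antisym subsetI)
    fix w assume w: "w \<in> ?L"
    then obtain u b where u: "w = u @ [b]" by (cases w rule: rev_cases) auto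
    with w have "walk u" "length u = Suc n" "u \<noteq> []" "(last u, b) \<in> R" by (auto simp: walk_append_iff)
    then show "w \<in> ?R" unfolding u by force
  next
    fix w assume "w \<in> ?R"
    then show "w \<in> ?L" by (auto simp: walk_append_iff dest: edge_in_V)
  qed
  have "(\<Sum>w\<in>?L. r (last w)) = (\<Sum>(w, b)\<in>(SIGMA w:?W. R `` {last w}). r b)"
    unfolding bij by (subst sum.reindex) (auto simp: inj_on_def case_prod_beta)
  also have "\<dots> = (\<Sum>w\<in>?W. \<Sum>b\<in>R `` {last w}. r b)"
    using finW finR by (subst sum.Sigma) auto
  also have "\<dots> = (\<Sum>w\<in>?W. \<alpha> * r (last w))"
  proof (intro sum.cong refl assms)
    fix w assume "w \<in> ?W"
    then have "w \<noteq> []" "set w \<subseteq> V" by (auto simp: walk_def)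
    then show "last w \<in> V" by auto
  qed
  also have "\<dots> = \<alpha> ^ Suc n * (\<Sum>a\<in>V. r a)"
    using Suc by (simp add: sum_distrib_left[symmetric])
  finally show ?case .
qed

text \<open>As \<open>r\<close> is bounded above and away from zero, the number of walks of length \<open>n + 1\<close> lies between two
  constant multiples of \<open>\<alpha> ^ n\<close>.\<close>

lemma entropy_paths:
  fixes r :: "'a \<Rightarrow> real"
  assumes eigen: "\<And>a. a \<in> V \<Longrightarrow> (\<Sum>b\<in>R `` {a}. r b) = \<alpha> * r a"
    and pos: "\<And>a. a \<in> V \<Longrightarrow> r a > 0" and \<alpha>: "\<alpha> > 0"
  shows "topological_entropy paths = ln \<alpha>"
proof -
  define W where "W n = {w. walk w \<and> length w = n}" for n
  define s where "s = (\<Sum>a\<in>V. r a)"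
  define lo hi where "lo = Min (r ` V)" and "hi = Max (r ` V)"
  have lo: "lo \<le> r a" if "a \<in> V" for a using that fin by (auto simp: lo_def)
  have hi: "r a \<le> hi" if "a \<in> V" for a using that fin by (auto simp: hi_def)
  have lo0: "lo > 0" using fin nonempty pos by (simp add: lo_def)
  obtain a where "a \<in> V" using nonempty by blast
  then have hi0: "hi > 0" using pos hi by fastforce
  have s0: "s > 0" unfolding s_def using fin nonempty pos by (intro sum_pos) auto
  have last: "last w \<in> V" if "w \<in> W (Suc n)" for w n
  proof -
    from that have "w \<noteq> []" "set w \<subseteq> V" by (auto simp: W_def walk_def)
    then show ?thesis by auto
  qed
  have sum: "(\<Sum>w\<in>W (Suc n). r (last w)) = \<alpha> ^ n * s" for n
    using eigenvector_sum_walks[OF eigen] by (simp add: W_def s_def)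
  have up: "real (card (W (Suc n))) * lo \<le> \<alpha> ^ n * s" for n
    unfolding sum[symmetric] using last lo by (intro sum_bounded_below) auto
  have dn: "\<alpha> ^ n * s \<le> real (card (W (Suc n))) * hi" for n
    unfolding sum[symmetric] using last hi by (intro sum_bounded_above) auto
  have card0: "real (card (W (Suc n))) > 0" for n
    using dn[of n] hi0 s0 \<alpha> by (smt (verit) mult_nonpos_nonneg zero_less_mult_iff zero_less_power)
  have ub: "ln (real (card (W (Suc n)))) \<le> real n * ln \<alpha> + ln (s / lo)" for n
  proof -
    have "real (card (W (Suc n))) \<le> \<alpha> ^ n * (s / lo)"
      using up[of n] lo0 by (simp add: field_simps)
    then have "ln (real (card (W (Suc n)))) \<le> ln (\<alpha> ^ n * (s / lo))"
      using card0 by (intro ln_mono) auto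
    moreover have "ln (\<alpha> ^ n * (s / lo)) = real n * ln \<alpha> + ln (s / lo)"
      using \<alpha> s0 lo0 by (subst ln_mult_pos) (auto simp: ln_realpow)
    ultimately show ?thesis by simp
  qed
  have lb: "real n * ln \<alpha> + ln (s / hi) \<le> ln (real (card (W (Suc n))))" for n
  proof -
    have "\<alpha> ^ n * (s / hi) \<le> real (card (W (Suc n)))"
      using dn[of n] hi0 by (simp add: field_simps)
    then have "ln (\<alpha> ^ n * (s / hi)) \<le> ln (real (card (W (Suc n))))"
      using \<alpha> s0 hi0 by (intro ln_mono) auto
    moreover have "ln (\<alpha> ^ n * (s / hi)) = real n * ln \<alpha> + ln (s / hi)"
      using \<alpha> s0 hi0 by (subst ln_mult_pos) (auto simp: ln_realpow)
    ultimately show ?thesis by simp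
  qed
  have lim: "(\<lambda>n. (real n * ln \<alpha> + c) / real (Suc n)) \<longlonglongrightarrow> ln \<alpha>" for c
  proof -
    have "(\<lambda>n. ln \<alpha> + (c - ln \<alpha>) * inverse (real (Suc n))) \<longlonglongrightarrow> ln \<alpha> + (c - ln \<alpha>) * 0"
      by (intro tendsto_intros LIMSEQ_inverse_real_of_nat)
    moreover have "(real n * ln \<alpha> + c) / real (Suc n) = ln \<alpha> + (c - ln \<alpha>) * inverse (real (Suc n))" for n
      by (simp add: field_simps)
    ultimately show ?thesis by simp
  qed
  have "(\<lambda>n. ln (real (card (W (Suc n)))) / real (Suc n)) \<longlonglongrightarrow> ln \<alpha>"
  proof (rule tendsto_sandwich[OF _ _ lim lim])
    show "\<forall>\<^sub>F n in sequentially. (real n * ln \<alpha> + ln (s / hi)) / real (Suc n)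
        \<le> ln (real (card (W (Suc n)))) / real (Suc n)"
      using lb by (intro always_eventually allI divide_right_mono) auto
    show "\<forall>\<^sub>F n in sequentially. ln (real (card (W (Suc n)))) / real (Suc n)
        \<le> (real n * ln \<alpha> + ln (s / lo)) / real (Suc n)"
      using ub by (intro always_eventually allI divide_right_mono) auto
  qed
  then have "(\<lambda>n. ln (real (card (W n))) / real n) \<longlonglongrightarrow> ln \<alpha>"
    by (subst (asm) filterlim_sequentially_Suc)
  then show ?thesis
    unfolding topological_entropy_def words_of_length_paths W_def by (rule limI)
qed

end

section \<open>The minimal polynomial of a Perron number\<close>

lemma map_poly_mult_hom:
  fixes h :: "'a::comm_semiring_0 \<Rightarrow> 'b::comm_semiring_0"
  assumes "h 0 = 0" "\<And>a b. h (a + b) = h a + h b" "\<And>a b. h (a * b) = h a * h b"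
  shows "map_poly h (p * q) = map_poly h p * map_poly h q"
proof (rule poly_eqI)
  fix n
  have sum: "h (sum f A) = (\<Sum>i\<in>A. h (f i))" for f :: "nat \<Rightarrow> 'a" and A
    by (induction A rule: infinite_finite_induct) (auto simp: assms)
  show "coeff (map_poly h (p * q)) n = coeff (map_poly h p * map_poly h q) n"
    by (simp add: coeff_map_poly coeff_mult assms sum)
qed

lemma map_poly_add_hom:
  fixes h :: "'a::comm_monoid_add \<Rightarrow> 'b::comm_monoid_add"
  assumes "h 0 = 0" "\<And>a b. h (a + b) = h a + h b"
  shows "map_poly h (p + q) = map_poly h p + map_poly h q"
  by (rule poly_eqI) (simp add: coeff_map_poly assms)

abbreviation rpoly :: "rat poly \<Rightarrow> complex poly" where "rpoly \<equiv> map_poly of_rat"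
abbreviation ipoly :: "int poly \<Rightarrow> complex poly" where "ipoly \<equiv> map_poly of_int"

lemma rpoly_mult: "rpoly (p * q) = rpoly p * rpoly q"
  by (rule map_poly_mult_hom) (auto simp: of_rat_add of_rat_mult)

lemma rpoly_add: "rpoly (p + q) = rpoly p + rpoly q"
  by (rule map_poly_add_hom) (auto simp: of_rat_add)

lemma rpoly_of_int: "rpoly (map_poly of_int p) = ipoly p"
  by (rule poly_eqI) (simp add: coeff_map_poly)

lemma rpoly_pderiv: "rpoly (pderiv p) = pderiv (rpoly p)"
  by (rule poly_eqI) (simp add: coeff_map_poly coeff_pderiv of_rat_mult of_rat_add)

text \<open>The rational polynomials vanishing at \<open>z\<close> form an ideal; a nonzero element of least degree generates
  it by division with remainder.\<close>

lemma annihilator_generator: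
  assumes "p \<noteq> 0" "poly (rpoly p) z = 0"
  obtains q where "q \<noteq> 0" "poly (rpoly q) z = 0"
    "\<And>p. poly (rpoly p) z = 0 \<Longrightarrow> q dvd p"
proof -
  define Q where "Q d \<longleftrightarrow> (\<exists>p. p \<noteq> 0 \<and> poly (rpoly p) z = 0 \<and> degree p = d)" for d
  have "Q (degree p)" using assms by (auto simp: Q_def)
  then have "Q (LEAST d. Q d)" by (rule LeastI)
  then obtain q where q: "q \<noteq> 0" "poly (rpoly q) z = 0" "degree q = (LEAST d. Q d)"
    by (auto simp: Q_def)
  have "q dvd p" if "poly (rpoly p) z = 0" for p
  proof (rule ccontr)
    assume "\<not> q dvd p"
    then have r: "p mod q \<noteq> 0" by (simp add: dvd_eq_mod_eq_0)
    have "poly (rpoly (p div q * q + p mod q)) z = 0" using that by simp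
    then have "poly (rpoly (p mod q)) z = 0" unfolding rpoly_add rpoly_mult using q by simp
    with r have "Q (degree (p mod q))" by (auto simp: Q_def)
    then have "degree q \<le> degree (p mod q)" unfolding q(3) by (rule Least_le)
    moreover have "degree (p mod q) < degree q" using degree_mod_less[OF q(1), of p] r by simp
    ultimately show False by simp
  qed
  with q show thesis by (intro that)
qed

lemma is_unit_no_root: "is_unit p \<Longrightarrow> poly (rpoly p) z \<noteq> 0"
  by (auto simp: is_unit_poly_iff map_poly_pCons)

lemma irreducible_dvd_of_common_root:
  assumes "irreducible m" "poly (rpoly m) z = 0" "poly (rpoly p) z = 0"
  shows "m dvd p"
proof -
  have "m \<noteq> 0" using assms(1) by auto
  then obtain q where q: "q \<noteq> 0" "poly (rpoly q) z = 0" "\<And>p. poly (rpoly p) z = 0 \<Longrightarrow> q dvd p"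
    using assms(2) annihilator_generator by blast
  obtain g where g: "m = q * g" using q(3)[OF assms(2)] by blast
  have "is_unit g" using irreducibleD[OF assms(1) g] is_unit_no_root q(2) by blast
  then have "m dvd q" unfolding g by (simp add: mult_unit_dvd_iff)
  also have "q dvd p" using q(3) assms(3) by blast
  finally show ?thesis .
qed

lemma min_rat_poly_exists:
  assumes "p \<noteq> 0" "poly (rpoly p) x = 0"
  shows "\<exists>m. min_rat_poly x m"
proof -
  obtain q where q: "q \<noteq> 0" "poly (rpoly q) x = 0" "\<And>p. poly (rpoly p) x = 0 \<Longrightarrow> q dvd p"
    using annihilator_generator[OF assms] by blast
  define m where "m = smult (inverse (lead_coeff q)) q"
  have "rpoly m = smult (of_rat (inverse (lead_coeff q))) (rpoly q)"
    unfolding m_def by (rule poly_eqI) (simp add: coeff_map_poly of_rat_mult)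
  then have m: "m \<noteq> 0" "lead_coeff m = 1" "poly (rpoly m) x = 0"
    using q by (auto simp: m_def)
  have dvd: "m dvd p" if "poly (rpoly p) x = 0" for p
    using q(1) q(3)[OF that] by (auto simp: m_def smult_dvd_iff)
  have "irreducible m"
  proof (rule irreducibleI)
    show "\<not> is_unit m" using is_unit_no_root m(3) by blast
    fix a b assume ab: "m = a * b"
    with m(1) have "a \<noteq> 0" "b \<noteq> 0" by auto
    from ab m have "poly (rpoly a) x = 0 \<or> poly (rpoly b) x = 0" by (simp add: rpoly_mult)
    then have "a * b dvd a * 1 \<or> a * b dvd 1 * b"
    proof
      assume "poly (rpoly a) x = 0"
      then show ?thesis using dvd[of a] unfolding ab by simp
    next
      assume "poly (rpoly b) x = 0"
      then show ?thesis using dvd[of b] unfolding ab by simp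
    qed
    then show "is_unit a \<or> is_unit b"
      using \<open>a \<noteq> 0\<close> \<open>b \<noteq> 0\<close> by (simp only: dvd_mult_cancel_left dvd_mult_cancel_right) blast
  qed (rule m(1))
  with m show ?thesis by (auto simp: min_rat_poly_def)
qed

text \<open>Clear denominators by any positive integer \<open>a\<close>. Then \<open>a\<close> is the leading coefficient of the resulting
  integer polynomial, so its content divides \<open>a\<close> and can be cancelled on both sides.\<close>

lemma monic_clear_denominators:
  fixes p :: "rat poly"
  assumes "lead_coeff p = 1"
  obtains a P where "a > 0" "smult (of_int a) p = map_poly of_int P" "content P = 1"
proof -
  have "\<exists>a>0. \<exists>P. smult (of_int a) q = map_poly of_int P" for q :: "rat poly"
  proof (induction q)
    case 0
    then show ?case by (intro exI[of _ 1] exI[of _ 0] conjI) auto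
  next
    case (pCons c q)
    then obtain a P where a: "a > 0" "smult (of_int a) q = map_poly of_int P" by blast
    obtain u v where c: "c = of_int u / of_int v" "v > 0"
      by (metis Fract_of_int_quotient Rat_cases)
    have "smult (of_int (a * v)) (pCons c q) = map_poly of_int (pCons (a * u) (smult v P))"
    proof -
      have "smult (of_int (a * v)) q = smult (of_int v) (smult (of_int a) q)" by (simp add: mult.commute)
      also have "\<dots> = map_poly of_int (smult v P)"
        unfolding a(2) by (rule poly_eqI) (simp add: coeff_map_poly)
      finally show ?thesis using c by (simp add: map_poly_pCons)
    qed
    with a c show ?case by (intro exI[of _ "a * v"]) auto
  qed
  then obtain a P where a: "a > 0" "smult (of_int a) p = map_poly of_int P" by blast
  have "coeff (smult (of_int a) p) (degree p) = of_int a" using assms by simp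
  then have "of_int (coeff P (degree p)) = (of_int a :: rat)" unfolding a(2) by (simp add: coeff_map_poly)
  then have "coeff P (degree p) = a" by simp
  then have "content P dvd a" using content_dvd_coeff by metis
  then obtain b where b: "a = content P * b" by blast
  have P0: "content P > 0"
    using a b by (metis content_eq_zero_iff dual_order.irrefl less_le mult_zero_left normalize_content abs_ge_zero normalize_int_def)
  define P' where "P' = primitive_part P"
  have P: "P = smult (content P) P'" by (simp add: P'_def)
  have "b > 0" using a(1) b P0 by (simp add: zero_less_mult_iff)
  moreover have "smult (of_int b) p = map_poly of_int P'"
  proof (rule poly_eqI)
    fix n
    have "of_int a * coeff p n = of_int (coeff P n)"
      using arg_cong[OF a(2), of "\<lambda>p. coeff p n"] by (simp add: coeff_map_poly)
    also have "coeff P n = content P * coeff P' n" by (subst P) simp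
    finally have "of_int (content P) * (of_int b * coeff p n) = of_int (content P) * of_int (coeff P' n)"
      by (simp add: b)
    then show "coeff (smult (of_int b) p) n = coeff (map_poly of_int P') n"
      using P0 by (auto simp: coeff_map_poly)
  qed
  moreover have "content P' = 1" using P0 unfolding P'_def by (intro content_primitive_part) auto
  ultimately show thesis by (rule that)
qed

text \<open>Gauss's lemma: if \<open>a\<close> and \<open>b\<close> clear the denominators of the two monic factors and leave content 1,
  then multiplicativity of the content gives \<open>a * b = 1\<close>, so there were no denominators.\<close>

lemma monic_rat_factor_of_int_poly:
  fixes m :: "rat poly" and q :: "int poly"
  assumes "lead_coeff m = 1" "lead_coeff q = 1" "m dvd map_poly of_int q"
  obtains M where "m = map_poly of_int M"
proof -
  from assms(3) obtain g where g: "map_poly of_int q = m * g" by blast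
  have "lead_coeff (map_poly of_int q :: rat poly) = 1"
    using assms(2) by (simp add: coeff_map_poly degree_map_poly)
  then have "lead_coeff g = 1" using assms(1) unfolding g lead_coeff_mult by simp
  then obtain b G where b: "b > 0" "smult (of_int b) g = map_poly of_int G" "content G = 1"
    by (rule monic_clear_denominators)
  obtain a M where a: "a > 0" "smult (of_int a) m = map_poly of_int M" "content M = 1"
    using assms(1) by (rule monic_clear_denominators)
  have "map_poly of_int (smult (a * b) q) = smult (of_int (a * b)) (map_poly of_int q :: rat poly)"
    by (rule poly_eqI) (simp add: coeff_map_poly)
  also have "\<dots> = smult (of_int a) m * smult (of_int b) g" unfolding g by (simp add: mult_ac)
  also have "\<dots> = map_poly of_int (M * G)" unfolding a b by (rule map_poly_mult_hom[symmetric]) auto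
  finally have "of_int (coeff (smult (a * b) q) n) = (of_int (coeff (M * G) n) :: rat)" for n
    unfolding poly_eq_iff by (simp add: coeff_map_poly)
  then have "smult (a * b) q = M * G" by (intro poly_eqI) (metis of_int_eq_iff)
  then have "normalize (a * b) * content q = 1"
    using a(3) b(3) by (metis content_mult content_smult mult_1)
  then have "a * b * content q = 1" using a(1) b(1) by simp
  then have "a = 1" using a(1) b(1)
    by (metis dvd_triv_left mult.assoc zdvd1_eq abs_of_pos)
  with a(2) show thesis by (intro that[of M]) simp
qed

text \<open>The minimal polynomial divides a monic integer polynomial, so it is integral by Gauss's lemma. It has
  no multiple root, because it would divide its derivative, which has smaller degree.\<close>

lemma perron_minimal_polynomial:
  assumes "perron_number \<alpha>"
  obtains m :: "int poly" where "lead_coeff m = 1" "degree m > 0" "poly (ipoly m) (of_real \<alpha>) = 0"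
    "\<And>z. poly (ipoly m) z = 0 \<Longrightarrow> z \<noteq> of_real \<alpha> \<Longrightarrow> cmod z < \<alpha>"
    "card {z. poly (ipoly m) z = 0} = degree m"
proof -
  from assms have \<alpha>: "algebraic_int \<alpha>" "1 \<le> \<alpha>"
    "\<And>z. z \<in> conjugates (of_real \<alpha>) \<Longrightarrow> z \<noteq> of_real \<alpha> \<Longrightarrow> cmod z < \<alpha>"
    by (auto simp: perron_number_def)
  have "algebraic_int (complex_of_real \<alpha>)" using \<alpha>(1) by (rule algebraic_int_of_real)
  then obtain q :: "int poly" where qc: "poly (ipoly q) (of_real \<alpha>) = 0" and q: "lead_coeff q = 1"
    using algebraic_int_altdef_ipoly by blast
  have "map_poly of_int q \<noteq> (0 :: rat poly)"
    using q by (metis coeff_0 coeff_map_poly of_int_0 of_int_1 zero_neq_one)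
  then obtain r where r: "min_rat_poly (of_real \<alpha>) r"
    using min_rat_poly_exists qc by (metis rpoly_of_int)
  then have r': "lead_coeff r = 1" "irreducible r" "poly (rpoly r) (of_real \<alpha>) = 0"
    by (auto simp: min_rat_poly_def)
  have "r dvd map_poly of_int q"
    using irreducible_dvd_of_common_root[OF r'(2,3)] qc by (simp add: rpoly_of_int)
  then obtain m where m: "r = map_poly of_int m"
    using monic_rat_factor_of_int_poly r'(1) q by blast
  have mr: "ipoly m = rpoly r" by (simp add: m rpoly_of_int)
  have deg: "degree r = degree m" unfolding m by (simp add: degree_map_poly)
  have dc: "degree (rpoly r) = degree r" by (simp add: degree_map_poly)
  have rpos: "degree r > 0"
    using r'(2) by (metis irreducible_const_poly_iff is_unit_iff_degree irreducible_def neq0_conv)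
  have simple: "poly (pderiv (rpoly r)) z \<noteq> 0" if "poly (rpoly r) z = 0" for z
  proof
    assume "poly (pderiv (rpoly r)) z = 0"
    then have "r dvd pderiv r"
      using irreducible_dvd_of_common_root[OF r'(2) that, of "pderiv r"] unfolding rpoly_pderiv by blast
    with rpos show False by simp
  qed
  have "rsquarefree (rpoly r)" using simple by (auto simp: rsquarefree_roots)
  then have "card {z. poly (rpoly r) z = 0} = degree m"
  proof -
    assume sf: "rsquarefree (rpoly r)"
    let ?S = "{z. poly (rpoly r) z = 0}"
    have "lead_coeff (rpoly r) = 1" using r'(1) by (simp add: dc coeff_map_poly)
    then have "rpoly r = (\<Prod>z\<in>?S. [:- z, 1:])"
      using complex_poly_decompose_rsquarefree[OF sf] by simp
    then have "degree (rpoly r) = (\<Sum>z\<in>?S. degree [:- z, 1:])"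
      using degree_prod_sum_eq[of ?S "\<lambda>z. [:- z, 1:]"] by simp
    then show ?thesis using dc deg by simp
  qed
  moreover have "lead_coeff m = 1"
  proof -
    have "of_int (lead_coeff m) = (1 :: rat)" using r'(1) deg by (simp add: m coeff_map_poly)
    then show ?thesis by simp
  qed
  moreover have "cmod z < \<alpha>" if "poly (ipoly m) z = 0" "z \<noteq> of_real \<alpha>" for z
    using \<alpha>(3)[of z] that r by (auto simp: conjugates_def mr)
  ultimately show thesis using rpos r'(3) deg mr by (intro that[of m]) auto
qed

section \<open>Rounding in the dominant cone\<close>

lemma ipoly_add: "ipoly (p + q) = ipoly p + ipoly q"
  by (rule map_poly_add_hom) auto

lemma ipoly_smult: "ipoly (smult c p) = smult (of_int c) (ipoly p)"
  by (rule poly_eqI) (simp add: coeff_map_poly)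

lemma ipoly_diff: "ipoly (p - q) = ipoly p - ipoly q"
  by (rule poly_eqI) (simp add: coeff_map_poly)

text \<open>Lagrange interpolation expresses the coefficients as fixed linear combinations of the values on \<open>B\<close>.\<close>

lemma interpolation_coeff_bound:
  fixes B :: "complex set"
  assumes "finite B"
  shows "\<exists>K\<ge>0. \<forall>p j T. degree p < card B \<longrightarrow> (\<forall>b\<in>B. cmod (poly p b) \<le> T) \<longrightarrow> cmod (coeff p j) \<le> K * T"
proof -
  define l where "l b = smult (inverse (\<Prod>c\<in>B - {b}. b - c)) (\<Prod>c\<in>B - {b}. [:- c, 1:])" for b
  have l_self: "poly (l b) b = 1" if "b \<in> B" for b
    using assms unfolding l_def by (simp add: poly_prod)
  have l_other: "poly (l b) c = 0" if "c \<in> B" "c \<noteq> b" for b c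
    using assms that unfolding l_def by (auto simp: poly_prod)
  have deg_l: "degree (l b) < card B" if "b \<in> B" for b
  proof -
    have "degree (\<Prod>c\<in>B - {b}. [:- c, 1:]) = card (B - {b})"
      by (subst degree_prod_sum_eq) auto
    then have "degree (l b) \<le> card (B - {b})"
      unfolding l_def using degree_smult_le by metis
    also have "\<dots> < card B" using assms that by (rule card_Diff1_less)
    finally show ?thesis .
  qed
  define K where "K = (\<Sum>b\<in>B. \<Sum>j\<le>card B. cmod (coeff (l b) j))"
  have K: "cmod (coeff p j) \<le> K * T"
    if p: "degree p < card B" "\<forall>b\<in>B. cmod (poly p b) \<le> T" for p j T
  proof -
    define q where "q = (\<Sum>b\<in>B. smult (poly p b) (l b))"
    have "degree q < card B"
      unfolding q_def using p(1) deg_l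
      by (intro degree_sum_less) (auto intro: le_less_trans[OF degree_smult_le])
    then have deg: "degree (p - q) < card B" using p(1) by (rule_tac degree_diff_less) auto
    have "poly (p - q) b = 0" if "b \<in> B" for b
    proof -
      have "poly q b = (\<Sum>c\<in>B. if c = b then poly p b else 0)"
        unfolding q_def poly_sum by (intro sum.cong) (auto simp: l_self l_other that)
      also have "\<dots> = poly p b" using assms that by simp
      finally show ?thesis by simp
    qed
    then have sub: "B \<subseteq> {x. poly (p - q) x = 0}" by blast
    have "p - q = 0"
    proof (rule ccontr)
      assume nz: "p - q \<noteq> 0"
      then have "card B \<le> card {x. poly (p - q) x = 0}"
        by (intro card_mono sub poly_roots_finite)
      also have "\<dots> \<le> degree (p - q)" using nz by (rule card_poly_roots_bound)
      finally show False using deg by simp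
    qed
    then have "p = q" by simp
    then have "coeff p j = coeff q j" by simp
    also have "\<dots> = (\<Sum>b\<in>B. poly p b * coeff (l b) j)" by (simp add: q_def coeff_sum)
    finally have eq: "coeff p j = (\<Sum>b\<in>B. poly p b * coeff (l b) j)" .
    have B0: "B \<noteq> {}" using p(1) by auto
    then have T: "T \<ge> 0" using p(2) by (meson all_not_in_conv norm_ge_zero order_trans)
    have "cmod (coeff p j) \<le> (\<Sum>b\<in>B. cmod (poly p b * coeff (l b) j))"
      unfolding eq by (rule norm_sum)
    also have "\<dots> \<le> (\<Sum>b\<in>B. (\<Sum>j\<le>card B. cmod (coeff (l b) j)) * T)"
    proof (rule sum_mono)
      fix b assume b: "b \<in> B"
      have "cmod (coeff (l b) j) \<le> (\<Sum>j\<le>card B. cmod (coeff (l b) j))"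
      proof (cases "j \<le> card B")
        case True
        then show ?thesis by (intro member_le_sum) auto
      next
        case False
        then have "coeff (l b) j = 0" using deg_l[OF b] by (intro coeff_eq_0) auto
        then show ?thesis by (simp add: sum_nonneg)
      qed
      then have "cmod (poly p b) * cmod (coeff (l b) j) \<le> T * (\<Sum>j\<le>card B. cmod (coeff (l b) j))"
        using p(2) b T by (intro mult_mono) auto
      then show "cmod (poly p b * coeff (l b) j) \<le> (\<Sum>j\<le>card B. cmod (coeff (l b) j)) * T"
        by (simp add: norm_mult mult.commute)
    qed
    also have "\<dots> = K * T" by (simp add: K_def sum_distrib_right)
    finally show ?thesis .
  qed
  have "K \<ge> 0" unfolding K_def by (intro sum_nonneg) auto
  with K show ?thesis by blast
qed

lemma finite_int_polys_bounded_coeff: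
  "finite {p :: int poly. degree p < d \<and> (\<forall>j. \<bar>coeff p j\<bar> \<le> M)}"
proof -
  have "{p :: int poly. degree p < d \<and> (\<forall>j. \<bar>coeff p j\<bar> \<le> M)}
      \<subseteq> Poly ` {xs. set xs \<subseteq> {-M..M} \<and> length xs \<le> d}"
  proof
    fix p :: "int poly" assume p: "p \<in> {p. degree p < d \<and> (\<forall>j. \<bar>coeff p j\<bar> \<le> M)}"
    then have "set (coeffs p) \<subseteq> {-M..M}"
      by (auto simp: coeffs_def abs_le_iff) (smt (verit))+
    moreover have "length (coeffs p) \<le> d" using p by (cases "p = 0") (auto simp: length_coeffs)
    ultimately show "p \<in> Poly ` {xs. set xs \<subseteq> {-M..M} \<and> length xs \<le> d}"
      by (intro image_eqI[of _ _ "coeffs p"]) auto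
  qed
  then show ?thesis
    by (rule finite_subset) (intro finite_imageI finite_lists_length_le finite_atLeastAtMost_int)
qed

locale perron_poly =
  fixes m :: "int poly" and \<alpha> :: real
  assumes monic: "lead_coeff m = 1" and degree_pos: "degree m > 0"
    and root: "poly (ipoly m) (of_real \<alpha>) = 0"
    and dominant: "\<And>z. poly (ipoly m) z = 0 \<Longrightarrow> z \<noteq> of_real \<alpha> \<Longrightarrow> cmod z < \<alpha>"
    and simple: "card {z. poly (ipoly m) z = 0} = degree m"
    and gt1: "\<alpha> > 1"
begin

definition conj_roots :: "complex set" where
  "conj_roots = {z. poly (ipoly m) z = 0} - {of_real \<alpha>}"

definition val :: "int poly \<Rightarrow> real" where
  "val p = poly (map_poly of_int p) \<alpha>"

text \<open>The integer points, in the coordinates \<open>1, x, x ^ 2, \<dots>\<close> of the ring of integer polynomials modulo \<open>m\<close>,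
  of a cone around the eigenline of multiplication by \<open>x\<close> that belongs to \<open>\<alpha>\<close>. The smaller \<open>c\<close>, the
  narrower the cone.\<close>

definition cone :: "real \<Rightarrow> int poly set" where
  "cone c = {p. degree p < degree m \<and> val p > 0 \<and> (\<forall>b\<in>conj_roots. cmod (poly (ipoly p) b) \<le> c * val p)}"

text \<open>Multiplication by \<open>x\<close> modulo the monic polynomial \<open>m\<close>, for arguments of degree less than \<open>degree m\<close>.\<close>

definition mult_x :: "int poly \<Rightarrow> int poly" where
  "mult_x p = pCons 0 p - smult (coeff p (degree m - 1)) m"

lemma ipoly_val: "poly (ipoly p) (of_real \<alpha>) = of_real (val p)"
  by (induction p) (auto simp: val_def map_poly_pCons)

lemma val_eq: "val p = Re (poly (ipoly p) (of_real \<alpha>))"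
  by (simp add: ipoly_val)

lemma val_diff: "val (p - q) = val p - val q"
  by (simp add: val_eq ipoly_diff)

lemma finite_roots: "finite {z. poly (ipoly m) z = 0}"
  using simple degree_pos card_ge_0_finite by metis

lemma root_conj: "b \<in> conj_roots \<Longrightarrow> poly (ipoly m) b = 0 \<and> cmod b < \<alpha>"
  using dominant by (auto simp: conj_roots_def)

lemma mult_x_eval: "poly (ipoly m) z = 0 \<Longrightarrow> poly (ipoly (mult_x p)) z = z * poly (ipoly p) z"
  by (simp add: mult_x_def ipoly_diff ipoly_smult map_poly_pCons)

lemma val_mult_x: "val (mult_x p) = \<alpha> * val p"
  using mult_x_eval[OF root, of p] by (simp add: ipoly_val flip: of_real_mult)

lemma degree_mult_x:
  assumes "degree p < degree m" shows "degree (mult_x p) < degree m"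
proof -
  have "coeff (mult_x p) n = 0" if "n \<ge> degree m" for n
  proof (cases "n = degree m")
    case True
    from degree_pos obtain k where k: "degree m = Suc k" by (cases "degree m") auto
    with monic have "coeff m (Suc k) = 1" by simp
    with True k show ?thesis by (simp add: mult_x_def)
  next
    case False
    with that have "n > degree m" by simp
    then obtain k where "n = Suc k" by (cases n) auto
    with \<open>n > degree m\<close> assms show ?thesis by (simp add: mult_x_def coeff_eq_0)
  qed
  with degree_pos show ?thesis
    by (metis coeff_0 degree_0 leading_coeff_neq_0 not_le)
qed

lemma spectral_gap:
  obtains \<rho> where "0 < \<rho>" "\<rho> < 1" "\<And>b. b \<in> conj_roots \<Longrightarrow> cmod b \<le> \<rho> * \<alpha>"
proof -
  have fin: "finite conj_roots" using finite_roots by (simp add: conj_roots_def)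
  define \<rho> where "\<rho> = Max (insert (1/2) ((\<lambda>b. cmod b / \<alpha>) ` conj_roots))"
  have "1/2 \<le> \<rho>" unfolding \<rho>_def using fin by (intro Max_ge) auto
  moreover have "\<rho> < 1"
    unfolding \<rho>_def using fin root_conj gt1 by (subst Max_less_iff) auto
  moreover have "cmod b \<le> \<rho> * \<alpha>" if "b \<in> conj_roots" for b
  proof -
    have "cmod b / \<alpha> \<le> \<rho>" unfolding \<rho>_def using fin that by (intro Max_ge) auto
    then show ?thesis using gt1 by (simp add: field_simps)
  qed
  ultimately show thesis by (intro that[of \<rho>]) auto
qed

lemma cone_mono: "c \<le> c' \<Longrightarrow> cone c \<subseteq> cone c'"
  unfolding cone_def by (auto intro: order_trans[OF _ mult_right_mono])

lemma mult_x_cone: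
  assumes \<rho>: "\<And>b. b \<in> conj_roots \<Longrightarrow> cmod b \<le> \<rho> * \<alpha>" "0 < \<rho>" and p: "p \<in> cone c"
  shows "mult_x p \<in> cone (\<rho> * c)"
proof -
  have "cmod (poly (ipoly (mult_x p)) b) \<le> \<rho> * c * val (mult_x p)" if b: "b \<in> conj_roots" for b
  proof -
    have "cmod (poly (ipoly (mult_x p)) b) = cmod b * cmod (poly (ipoly p) b)"
      using root_conj[OF b] by (simp add: mult_x_eval norm_mult)
    also have "\<dots> \<le> (\<rho> * \<alpha>) * (c * val p)"
      using \<rho> gt1 p b by (intro mult_mono) (auto simp: cone_def)
    finally show ?thesis by (simp add: val_mult_x mult_ac)
  qed
  then show ?thesis
    using p degree_mult_x gt1 by (auto simp: cone_def val_mult_x)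
qed

text \<open>The powers of \<open>\<alpha>\<close>: all other roots lose against \<open>\<alpha>\<close> exponentially.\<close>

lemma narrow_cone_element:
  assumes "\<delta> > 0"
  obtains z where "z \<in> cone \<delta>" "val z \<ge> L"
proof -
  obtain \<rho> where \<rho>: "0 < \<rho>" "\<rho> < 1" "\<And>b. b \<in> conj_roots \<Longrightarrow> cmod b \<le> \<rho> * \<alpha>"
    using spectral_gap by metis
  define z where "z n = (mult_x ^^ n) 1" for n
  have "z n \<in> cone (\<rho> ^ n)" for n
  proof (induction n)
    case 0
    show ?case using degree_pos by (simp add: z_def cone_def val_def)
  next
    case (Suc n)
    from mult_x_cone[OF \<rho>(3,1) this] show ?case by (simp add: z_def)
  qed
  moreover have "val (z n) = \<alpha> ^ n" for n
    by (induction n) (auto simp: z_def val_mult_x, simp add: val_def)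
  moreover obtain n1 where n1: "\<rho> ^ n1 < \<delta>" using real_arch_pow_inv[OF assms \<rho>(2)] by blast
  obtain n2 where n2: "\<alpha> ^ n2 > L" using real_arch_pow[OF gt1] by blast
  define n where "n = max n1 n2"
  have "\<rho> ^ n \<le> \<rho> ^ n1" unfolding n_def using \<rho> by (intro power_decreasing) auto
  moreover have "\<alpha> ^ n2 \<le> \<alpha> ^ n" unfolding n_def using gt1 by (intro power_increasing) auto
  ultimately show thesis using n1 n2 cone_mono[of "\<rho> ^ n" \<delta>] by (intro that[of "z n"]) auto
qed

text \<open>Bounded values at all roots of \<open>m\<close> bound the integer coefficients, by interpolation at the
  \<open>degree m\<close> distinct roots.\<close>

lemma finite_cone_bounded: "finite {p \<in> cone 1. val p \<le> T}"
proof -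
  obtain K where K: "K \<ge> 0" "\<And>p j T. degree p < degree m \<Longrightarrow>
      (\<forall>b\<in>{z. poly (ipoly m) z = 0}. cmod (poly p b) \<le> T) \<Longrightarrow> cmod (coeff p j) \<le> K * T"
    using interpolation_coeff_bound[OF finite_roots] unfolding simple by blast
  have "{p \<in> cone 1. val p \<le> T} \<subseteq> {p. degree p < degree m \<and> (\<forall>j. \<bar>coeff p j\<bar> \<le> \<lfloor>K * T\<rfloor>)}"
  proof safe
    fix p assume p: "p \<in> cone 1" "val p \<le> T"
    then show deg: "degree p < degree m" by (simp add: cone_def)
    fix j
    have "cmod (poly (ipoly p) b) \<le> T" if "poly (ipoly m) b = 0" for b
    proof (cases "b = of_real \<alpha>")
      case True
      then show ?thesis using p by (simp add: ipoly_val cone_def)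
    next
      case False
      then have "b \<in> conj_roots" using that by (simp add: conj_roots_def)
      then show ?thesis using p by (force simp: cone_def)
    qed
    moreover have "degree (ipoly p) < degree m" using deg by (simp add: degree_map_poly)
    ultimately have "cmod (coeff (ipoly p) j) \<le> K * T" by (intro K(2)) auto
    then have "real_of_int \<bar>coeff p j\<bar> \<le> K * T" by (simp add: coeff_map_poly)
    then show "\<bar>coeff p j\<bar> \<le> \<lfloor>K * T\<rfloor>" by (simp add: le_floor_iff)
  qed
  then show ?thesis using finite_int_polys_bounded_coeff finite_subset by blast
qed

definition rounded :: "nat \<Rightarrow> nat \<Rightarrow> int poly \<Rightarrow> int poly" where
  "rounded N k p = map_poly (\<lambda>c. (int k * c) div int N) p"

text \<open>The increments of the multiples \<open>k / N\<close> of \<open>p\<close>, rounded down coefficientwise: \<open>N\<close> integer polynomials that sum up to \<open>p\<close>, each close to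
  \<open>p / N\<close>.\<close>

definition piece :: "nat \<Rightarrow> nat \<Rightarrow> int poly \<Rightarrow> int poly" where
  "piece N k p = rounded N (Suc k) p - rounded N k p"

lemma degree_piece: "degree (piece N k p) \<le> degree p"
  unfolding piece_def rounded_def by (intro degree_diff_le map_poly_degree_leq)

lemma coeff_piece_close:
  assumes "N > 0"
  shows "\<bar>real_of_int (coeff (piece N k p) j) - coeff p j / N\<bar> \<le> 1"
proof -
  define u v where "u = int k * coeff p j" and "v = int (Suc k) * coeff p j"
  have "real_of_int (coeff (piece N k p) j) = real_of_int (v div int N) - real_of_int (u div int N)"
    by (simp add: piece_def rounded_def coeff_map_poly u_def v_def)
  moreover have "real_of_int (u div int N) = of_int \<lfloor>real_of_int u / N\<rfloor>"
    "real_of_int (v div int N) = of_int \<lfloor>real_of_int v / N\<rfloor>"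
    using floor_divide_of_int_eq[of u "int N", where ?'a = real]
      floor_divide_of_int_eq[of v "int N", where ?'a = real] by simp_all
  moreover have "real_of_int v / N - real_of_int u / N = coeff p j / N"
    by (simp add: u_def v_def distrib_right add_divide_distrib)
  ultimately show ?thesis by linarith
qed

lemma sum_val_pieces:
  assumes "N > 0" shows "(\<Sum>k<N. val (piece N k p)) = val p"
proof -
  have "(\<Sum>k<N. val (piece N k p)) = val (rounded N N p) - val (rounded N 0 p)"
    unfolding piece_def val_diff by (rule sum_lessThan_telescope)
  moreover have "rounded N N p = p" "rounded N 0 p = 0"
    using assms by (auto simp: rounded_def poly_eq_iff coeff_map_poly)
  ultimately show ?thesis by (simp add: val_def)
qed

lemma eval_piece_close:
  assumes "N > 0" "degree p < degree m" "cmod z \<le> \<alpha>"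
  shows "cmod (poly (ipoly (piece N k p)) z - poly (ipoly p) z / N) \<le> (\<Sum>j<degree m. \<alpha> ^ j)"
proof -
  have eval: "poly (ipoly q) z = (\<Sum>j<degree m. of_int (coeff q j) * z ^ j)"
    if "degree q < degree m" for q
  proof -
    have "poly (ipoly q) z = (\<Sum>j\<le>degree q. of_int (coeff q j) * z ^ j)"
      by (simp add: poly_altdef degree_map_poly coeff_map_poly)
    also have "\<dots> = (\<Sum>j<degree m. of_int (coeff q j) * z ^ j)"
      using that by (intro sum.mono_neutral_left) (auto simp: coeff_eq_0)
    finally show ?thesis .
  qed
  have "degree (piece N k p) < degree m" using degree_piece assms(2) by (rule le_less_trans)
  then have "poly (ipoly (piece N k p)) z - poly (ipoly p) z / N =
      (\<Sum>j<degree m. of_real (real_of_int (coeff (piece N k p) j) - coeff p j / N) * z ^ j)"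
    using assms(2) by (simp add: eval sum_divide_distrib algebra_simps flip: sum_subtractf)
  also have "cmod \<dots> \<le> (\<Sum>j<degree m. cmod (of_real (real_of_int (coeff (piece N k p) j) - coeff p j / N) * z ^ j))"
    by (rule norm_sum)
  also have "\<dots> \<le> (\<Sum>j<degree m. 1 * \<alpha> ^ j)"
  proof (intro sum_mono)
    fix j
    show "cmod (of_real (real_of_int (coeff (piece N k p) j) - coeff p j / N) * z ^ j) \<le> 1 * \<alpha> ^ j"
      unfolding norm_mult norm_of_real norm_power
      using coeff_piece_close[OF assms(1)] assms(3) by (intro mult_mono power_mono) auto
  qed
  finally show ?thesis by simp
qed

text \<open>With \<open>N\<close> pieces, where \<open>p(\<alpha>) / N\<close> lies between \<open>S\<close> and \<open>2 * S\<close>, rounding changes the values at all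
  roots by at most \<open>D\<close>. The slack \<open>(1 - c) * p(\<alpha>) / N\<close> between the narrow cone and \<open>cone 1\<close> absorbs an
  error of \<open>D\<close> on either side of the defining inequality as soon as \<open>(1 - c) * S \<ge> 2 * D\<close>.\<close>

lemma cone_decomposition:
  assumes "c < 1"
  obtains S where "S > 0" "\<And>p. p \<in> cone c \<Longrightarrow> val p \<ge> S \<Longrightarrow>
    \<exists>qs. set qs \<subseteq> {q \<in> cone 1. val q \<le> 3 * S} \<and> sum_list (map val qs) = val p"
proof -
  define D where "D = (\<Sum>j<degree m. \<alpha> ^ j)"
  have D: "D > 0" unfolding D_def using degree_pos gt1 by (intro sum_pos) auto
  define S where "S = max (2 * D) (2 * D / (1 - c))"
  have S: "S \<ge> 2 * D" "S * (1 - c) \<ge> 2 * D" "S > 0"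
    using assms D by (auto simp: S_def max_def field_simps)
  have "\<exists>qs. set qs \<subseteq> {q \<in> cone 1. val q \<le> 3 * S} \<and> sum_list (map val qs) = val p"
    if p: "p \<in> cone c" "val p \<ge> S" for p
  proof -
    define N where "N = nat \<lfloor>val p / S\<rfloor>"
    have fl: "1 \<le> \<lfloor>val p / S\<rfloor>" using p(2) S(3) by (simp add: le_floor_iff)
    then have "N > 0" by (simp add: N_def)
    have "real N = of_int \<lfloor>val p / S\<rfloor>" using fl by (simp add: N_def)
    then have N: "real N \<le> val p / S" "val p / S < real N + 1" by linarith+
    define s where "s = val p / N"
    have s: "S \<le> s" "s \<le> 2 * S"
    proof -
      show "S \<le> s" using N(1) \<open>N > 0\<close> S(3) by (simp add: s_def field_simps)
      have "val p < (real N + 1) * S" using N(2) S(3) by (simp add: field_simps)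
      also have "\<dots> \<le> (2 * real N) * S" using \<open>N > 0\<close> S(3) by (intro mult_right_mono) auto
      finally show "s \<le> 2 * S" using \<open>N > 0\<close> by (simp add: s_def field_simps)
    qed
    have deg: "degree p < degree m" using p(1) by (simp add: cone_def)
    have piece: "piece N k p \<in> cone 1 \<and> val (piece N k p) \<le> 3 * S" for k
    proof -
      have "cmod (poly (ipoly (piece N k p)) (of_real \<alpha>) - poly (ipoly p) (of_real \<alpha>) / N) \<le> D"
        unfolding D_def using \<open>N > 0\<close> deg gt1 by (intro eval_piece_close) auto
      also have "poly (ipoly (piece N k p)) (of_real \<alpha>) - poly (ipoly p) (of_real \<alpha>) / N
          = of_real (val (piece N k p) - s)"
        by (simp add: ipoly_val s_def)
      finally have close: "\<bar>val (piece N k p) - s\<bar> \<le> D" by (simp only: norm_of_real)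
      have "cmod (poly (ipoly (piece N k p)) b) \<le> val (piece N k p)" if b: "b \<in> conj_roots" for b
      proof -
        have "cmod (poly (ipoly (piece N k p)) b - poly (ipoly p) b / N) \<le> D"
          unfolding D_def using \<open>N > 0\<close> deg root_conj[OF b] by (intro eval_piece_close) auto
        moreover have "cmod (poly (ipoly p) b / N) \<le> c * s"
          using p(1) b \<open>N > 0\<close> by (auto simp: norm_divide s_def cone_def field_simps)
        moreover have "cmod (poly (ipoly (piece N k p)) b) \<le>
            cmod (poly (ipoly (piece N k p)) b - poly (ipoly p) b / N) + cmod (poly (ipoly p) b / N)"
          by (metis diff_add_cancel norm_triangle_ineq)
        moreover have "S * (1 - c) \<le> s * (1 - c)" using s(1) assms by (intro mult_right_mono) auto
        then have "c * s + 2 * D \<le> s" using S(2) by (simp add: algebra_simps)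
        ultimately show ?thesis using close by linarith
      qed
      moreover have "degree (piece N k p) < degree m" using degree_piece deg by (rule le_less_trans)
      moreover have "val (piece N k p) > 0" "val (piece N k p) \<le> 3 * S" using close s S D by linarith+
      ultimately show ?thesis by (auto simp: cone_def)
    qed
    define qs where "qs = map (\<lambda>k. piece N k p) [0..<N]"
    have "sum_list (map val qs) = val p"
      using sum_val_pieces[OF \<open>N > 0\<close>, of p]
      by (simp add: qs_def o_def interv_sum_list_conv_sum_set_nat atLeast0LessThan)
    with piece show ?thesis by (intro exI[of _ qs]) (auto simp: qs_def)
  qed
  with S(3) show thesis by (rule that)
qed

section \<open>A finite system of successors\<close>

text \<open>\<open>F\<close> consists of all elements of the cone of size at most \<open>T\<close>. As long as the product of \<open>\<alpha>\<close> and \<open>z\<close>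
  does not exceed \<open>T\<close>, it is itself the only successor of \<open>z\<close>. Otherwise \<open>z0\<close> is split off and the rest is decomposed, so
  that repeated multiplication by \<open>\<alpha>\<close> leads from every element to \<open>z0\<close>. The element \<open>z0\<close> is always
  treated in the second way, which makes it its own successor.\<close>

lemma finite_successor_system:
  obtains F :: "int poly set" and z0 L where
    "finite F" "z0 \<in> F" "z0 \<in> set (L z0)" "\<And>z. z \<in> F \<Longrightarrow> val z > 0"
    "\<And>z. z \<in> F \<Longrightarrow> set (L z) \<subseteq> F" "\<And>z. z \<in> F \<Longrightarrow> sum_list (map val (L z)) = \<alpha> * val z"
    "\<And>z. z \<in> F \<Longrightarrow> (z, z0) \<in> {(z, y). z \<in> F \<and> y \<in> set (L z)}\<^sup>*"
proof -
  obtain \<rho> where \<rho>: "0 < \<rho>" "\<rho> < 1" "\<And>b. b \<in> conj_roots \<Longrightarrow> cmod b \<le> \<rho> * \<alpha>"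
    using spectral_gap by metis
  \<comment> \<open>Products lie in \<open>cone \<rho>\<close>; the wider \<open>cone c\<close> leaves room for subtracting \<open>z0\<close>.\<close>
  define c where "c = (1 + \<rho>) / 2"
  have c: "\<rho> < c" "c < 1" "0 < c" using \<rho> by (auto simp: c_def)
  obtain S where S: "S > 0" "\<And>p. p \<in> cone c \<Longrightarrow> val p \<ge> S \<Longrightarrow>
    \<exists>qs. set qs \<subseteq> {q \<in> cone 1. val q \<le> 3 * S} \<and> sum_list (map val qs) = val p"
    using cone_decomposition[OF c(2)] by metis
  \<comment> \<open>Multiplication by \<open>\<alpha> - 1\<close> scales the value at \<open>\<alpha>\<close> by \<open>\<alpha> - 1\<close> and the values at the other
    roots by at most \<open>\<alpha> + 1\<close>; so \<open>(\<alpha> - 1) * z0\<close> lies in \<open>cone c\<close> for \<open>z0\<close> in \<open>cone \<delta>\<close>.\<close>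
  define \<delta> where "\<delta> = min 1 (c * (\<alpha> - 1) / (\<alpha> + 1))"
  have \<delta>: "\<delta> > 0" "\<delta> \<le> 1" using c gt1 by (auto simp: \<delta>_def)
  have "\<delta> \<le> c * (\<alpha> - 1) / (\<alpha> + 1)" by (simp add: \<delta>_def)
  then have \<delta>3: "(\<alpha> + 1) * \<delta> \<le> c * (\<alpha> - 1)" using gt1 by (simp add: field_simps)
  obtain z0 where z0: "z0 \<in> cone \<delta>" "val z0 \<ge> S / (\<alpha> - 1)"
    using narrow_cone_element[OF \<delta>(1)] by blast
  have z0pos: "val z0 > 0" using z0 by (simp add: cone_def)
  \<comment> \<open>The second and third bounds make the rest left after splitting off \<open>z0\<close> from a product larger
    than \<open>T\<close> large enough to be decomposed and keep it in \<open>cone c\<close>.\<close>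
  define T where "T = Max {3 * S, val z0 + S, (c + \<delta>) * val z0 / (c - \<rho>)}"
  have T: "3 * S \<le> T" "val z0 + S \<le> T" "(c + \<delta>) * val z0 / (c - \<rho>) \<le> T"
    by (auto simp: T_def)
  define F where "F = {p \<in> cone 1. val p \<le> T}"
  have z0F: "z0 \<in> F" using z0 T S(1) cone_mono[OF \<delta>(2)] by (auto simp: F_def)
  have split: "\<exists>qs. set qs \<subseteq> F \<and> sum_list (map val qs) = \<alpha> * val z - val z0"
    if z: "degree z < degree m" and v: "\<alpha> * val z - val z0 \<ge> S"
      and b: "\<And>b. b \<in> conj_roots \<Longrightarrow> cmod (b * poly (ipoly z) b - poly (ipoly z0) b) \<le> c * (\<alpha> * val z - val z0)"
    for z
  proof -
    have deg: "degree z0 < degree m" using z0 by (simp add: cone_def)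
    have "mult_x z - z0 \<in> cone c"
      using degree_diff_less[OF degree_mult_x[OF z] deg] v b S(1) root_conj
      by (auto simp: cone_def val_diff val_mult_x ipoly_diff mult_x_eval)
    from S(2)[OF this] v obtain qs where
      "set qs \<subseteq> {q \<in> cone 1. val q \<le> 3 * S}" "sum_list (map val qs) = \<alpha> * val z - val z0"
      by (auto simp: val_diff val_mult_x)
    with T(1) show ?thesis by (intro exI[of _ qs]) (auto simp: F_def)
  qed
  have split_z0: "\<exists>qs. set qs \<subseteq> F \<and> sum_list (map val qs) = \<alpha> * val z0 - val z0"
  proof (rule split)
    show "degree z0 < degree m" using z0 by (simp add: cone_def)
    show "S \<le> \<alpha> * val z0 - val z0" using z0(2) gt1 by (simp add: field_simps)
    fix b assume b: "b \<in> conj_roots"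
    have "cmod (b - 1) \<le> cmod b + 1" using norm_triangle_ineq4[of b 1] by simp
    then have "cmod (b - 1) \<le> \<alpha> + 1" using root_conj[OF b] by simp
    then have "cmod ((b - 1) * poly (ipoly z0) b) \<le> (\<alpha> + 1) * (\<delta> * val z0)"
      unfolding norm_mult using z0 b gt1 by (intro mult_mono) (auto simp: cone_def)
    also have "\<dots> = ((\<alpha> + 1) * \<delta>) * val z0" by simp
    also have "\<dots> \<le> (c * (\<alpha> - 1)) * val z0" using \<delta>3 z0pos by (intro mult_right_mono) auto
    finally show "cmod (b * poly (ipoly z0) b - poly (ipoly z0) b) \<le> c * (\<alpha> * val z0 - val z0)"
      by (simp add: algebra_simps)
  qed
  have split_large: "\<exists>qs. set qs \<subseteq> F \<and> sum_list (map val qs) = \<alpha> * val z - val z0"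
    if z: "z \<in> cone 1" "\<alpha> * val z > T" for z
  proof (rule split)
    show "degree z < degree m" using z by (simp add: cone_def)
    show "S \<le> \<alpha> * val z - val z0" using z T(2) by simp
    fix b assume b: "b \<in> conj_roots"
    have "cmod (b * poly (ipoly z) b) \<le> (\<rho> * \<alpha>) * (1 * val z)"
      unfolding norm_mult using z b \<rho> gt1 by (intro mult_mono) (auto simp: cone_def)
    moreover have "cmod (poly (ipoly z0) b) \<le> \<delta> * val z0" using z0 b by (simp add: cone_def)
    moreover have "cmod (b * poly (ipoly z) b - poly (ipoly z0) b) \<le>
        cmod (b * poly (ipoly z) b) + cmod (poly (ipoly z0) b)"
      by (rule norm_triangle_ineq4)
    moreover have "(c + \<delta>) * val z0 / (c - \<rho>) \<le> \<alpha> * val z" using T(3) z(2) by simp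
    then have "(c + \<delta>) * val z0 \<le> (c - \<rho>) * (\<alpha> * val z)" using c by (simp add: field_simps)
    ultimately show "cmod (b * poly (ipoly z) b - poly (ipoly z0) b) \<le> c * (\<alpha> * val z - val z0)"
      by (simp add: algebra_simps)
  qed
  define cut where "cut z = (SOME qs. set qs \<subseteq> F \<and> sum_list (map val qs) = \<alpha> * val z - val z0)" for z
  define big where "big z \<longleftrightarrow> z = z0 \<or> \<alpha> * val z > T" for z
  define L where "L z = (if big z then z0 # cut z else [mult_x z])" for z
  have cut: "set (cut z) \<subseteq> F \<and> sum_list (map val (cut z)) = \<alpha> * val z - val z0"
    if "z \<in> F" "big z" for z
  proof -
    have "\<exists>qs. set qs \<subseteq> F \<and> sum_list (map val qs) = \<alpha> * val z - val z0"
    proof (cases "z = z0")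
      case True
      then show ?thesis using split_z0 by simp
    next
      case False
      with that have "z \<in> cone 1" "\<alpha> * val z > T" by (auto simp: F_def big_def)
      then show ?thesis by (rule split_large)
    qed
    then show ?thesis unfolding cut_def by (rule someI_ex)
  qed
  have pos: "val z > 0" if "z \<in> F" for z using that by (simp add: F_def cone_def)
  have LF: "set (L z) \<subseteq> F" if "z \<in> F" for z
  proof (cases "big z")
    case True
    then show ?thesis using cut[OF that] z0F by (simp add: L_def)
  next
    case False
    have "mult_x z \<in> cone (\<rho> * 1)" using that \<rho> by (intro mult_x_cone) (auto simp: F_def)
    then have "mult_x z \<in> cone 1" using cone_mono[of "\<rho> * 1" 1] \<rho> by auto
    with False show ?thesis by (auto simp: L_def F_def big_def val_mult_x)
  qed
  have Lsum: "sum_list (map val (L z)) = \<alpha> * val z" if "z \<in> F" for z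
    using cut[OF that] by (auto simp: L_def val_mult_x)
  define E where "E = {(z, y). z \<in> F \<and> y \<in> set (L z)}"
  have reach: "(z, z0) \<in> E\<^sup>*" if "z \<in> F" "val z * \<alpha> ^ n > T" for z n
    using that
  proof (induction n arbitrary: z)
    case 0
    then show ?case by (simp add: F_def)
  next
    case (Suc n)
    show ?case
    proof (cases "big z")
      case True
      then have "(z, z0) \<in> E" using Suc.prems by (simp add: E_def L_def)
      then show ?thesis by blast
    next
      case False
      then have "mult_x z \<in> F" "(z, mult_x z) \<in> E"
        using LF[OF Suc.prems(1)] Suc.prems by (auto simp: E_def L_def)
      moreover have "val (mult_x z) * \<alpha> ^ n > T" using Suc.prems by (simp add: val_mult_x mult_ac)
      ultimately show ?thesis using Suc.IH by (meson converse_rtrancl_into_rtrancl)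
    qed
  qed
  have reach': "(z, z0) \<in> E\<^sup>*" if z: "z \<in> F" for z
  proof -
    obtain n where "T / val z < \<alpha> ^ n" using real_arch_pow[OF gt1] by blast
    then have "val z * \<alpha> ^ n > T" using pos[OF z] by (simp add: field_simps)
    with z show ?thesis by (rule reach)
  qed
  show thesis
    using that[of F z0 L] finite_cone_bounded[of T] z0F pos LF Lsum reach'
    unfolding E_def by (simp add: F_def L_def big_def)
qed

end

section \<open>From the successor system to a random substitution\<close>

lemma relpow_loop:
  assumes "(v0, v0) \<in> R" shows "(v0, v0) \<in> R ^^ n"
  using assms by (induction n) auto

text \<open>Walks through \<open>v0\<close> can be prolonged by any number of steps along the loop.\<close>

lemma mixing_graph_if_loop:
  assumes "finite V" "R \<subseteq> V \<times> V" "v0 \<in> V" "(v0, v0) \<in> R"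
    and conn: "\<And>v. v \<in> V \<Longrightarrow> (v, v0) \<in> R\<^sup>* \<and> (v0, v) \<in> R\<^sup>*"
  shows "mixing_graph V R"
proof
  show "finite V" "V \<noteq> {}" "R \<subseteq> V \<times> V" using assms by auto
  obtain i where i: "\<And>v. v \<in> V \<Longrightarrow> (v, v0) \<in> R ^^ i v"
    using conn unfolding rtrancl_power by metis
  obtain j where j: "\<And>v. v \<in> V \<Longrightarrow> (v0, v) \<in> R ^^ j v"
    using conn unfolding rtrancl_power by metis
  define N where "N = Max (i ` V) + Max (j ` V)"
  have "(a, b) \<in> R ^^ n" if "a \<in> V" "b \<in> V" "n \<ge> N" for a b n
  proof -
    have "i a \<le> Max (i ` V)" "j b \<le> Max (j ` V)" using that assms(1) by auto
    then have n: "n = i a + (n - i a - j b) + j b" using that by (simp add: N_def)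
    have "(a, v0) \<in> R ^^ (i a + (n - i a - j b))"
      using i[OF that(1)] relpow_loop[OF assms(4)] unfolding relpow_add by blast
    then have "(a, b) \<in> R ^^ (i a + (n - i a - j b) + j b)"
      using j[OF that(2)] unfolding relpow_add by blast
    then show ?thesis using n by simp
  qed
  then show "\<exists>N. \<forall>n\<ge>N. V \<times> V \<subseteq> R ^^ n" by blast
qed

lemma mixing_graph_inj_image:
  assumes "mixing_graph V R" "inj_on f V"
  shows "mixing_graph (f ` V) (map_prod f f ` R)"
proof -
  interpret mixing_graph V R by fact
  have pow: "(a, b) \<in> R ^^ n \<Longrightarrow> (f a, f b) \<in> (map_prod f f ` R) ^^ n" for a b n
  proof (induction n arbitrary: b)
    case (Suc n)
    then obtain c where "(a, c) \<in> R ^^ n" "(c, b) \<in> R" by auto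
    then have "(f a, f c) \<in> (map_prod f f ` R) ^^ n" "(f c, f b) \<in> map_prod f f ` R"
      using Suc.IH by (auto intro: rev_image_eqI)
    then show ?case by (simp only: relpow.simps) (rule relcompI)
  qed simp
  show ?thesis
  proof
    show "finite (f ` V)" "f ` V \<noteq> {}" "map_prod f f ` R \<subseteq> f ` V \<times> f ` V"
      using fin nonempty edges by auto
    obtain N where "\<And>n. n \<ge> N \<Longrightarrow> V \<times> V \<subseteq> R ^^ n" using mixing by blast
    then have "(f a, f b) \<in> (map_prod f f ` R) ^^ n" if "n \<ge> N" "a \<in> V" "b \<in> V" for a b n
      using pow that by blast
    then show "\<exists>N. \<forall>n\<ge>N. f ` V \<times> f ` V \<subseteq> (map_prod f f ` R) ^^ n" by blast
  qed
qed

text \<open>The list \<open>L z\<close> may repeat entries, so the successor system is a multigraph. An element \<open>y\<close> is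
  replaced by the pairs \<open>(y, l)\<close>, where \<open>l\<close> is the position in the list through which \<open>y\<close> is reached;
  this turns parallel edges into edges to distinct vertices. The vertices reachable from the one that
  represents the loop at \<open>z0\<close> form a strongly connected graph closed under successors, so that the
  eigenvector equation is inherited.\<close>

lemma mixing_graph_of_successor_system:
  fixes F :: "'v set" and val :: "'v \<Rightarrow> real"
  assumes F: "finite F" "z0 \<in> F" "z0 \<in> set (L z0)" "\<And>z. z \<in> F \<Longrightarrow> val z > 0"
    and LF: "\<And>z. z \<in> F \<Longrightarrow> set (L z) \<subseteq> F"
    and Lsum: "\<And>z. z \<in> F \<Longrightarrow> sum_list (map val (L z)) = \<alpha> * val z"
    and reach: "\<And>z. z \<in> F \<Longrightarrow> (z, z0) \<in> {(z, y). z \<in> F \<and> y \<in> set (L z)}\<^sup>*"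
  obtains V :: "('v \<times> nat) set" and R where "mixing_graph V R"
    "\<And>v. v \<in> V \<Longrightarrow> val (fst v) > 0"
    "\<And>v. v \<in> V \<Longrightarrow> (\<Sum>u\<in>R `` {v}. val (fst u)) = \<alpha> * val (fst v)"
proof -
  define R0 where "R0 = {((z, k :: nat), (y, l)). z \<in> F \<and> l < length (L z) \<and> L z ! l = y}"
  obtain l0 where l0: "l0 < length (L z0)" "L z0 ! l0 = z0" using F(3) by (auto simp: in_set_conv_nth)
  define v0 where "v0 = (z0, l0)"
  define V where "V = {v. (v0, v) \<in> R0\<^sup>*}"
  define R where "R = R0 \<inter> V \<times> V"
  have loop: "((z0, k), v0) \<in> R0" for k using l0 F(2) by (simp add: R0_def v0_def)
  have F_V: "fst v \<in> F" if "v \<in> V" for v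
  proof -
    from that have "(v0, v) \<in> R0\<^sup>*" by (simp add: V_def)
    then show ?thesis
    proof (cases rule: rtrancl.cases)
      case rtrancl_refl
      then show ?thesis using F(2) by (simp add: v0_def)
    next
      case (rtrancl_into_rtrancl u)
      then obtain z k where "u = (z, k)" "z \<in> F" "fst v \<in> set (L z)"
        by (cases v) (auto simp: R0_def)
      with LF \<open>z \<in> F\<close> show ?thesis by blast
    qed
  qed
  have "V \<subseteq> insert v0 (\<Union>z\<in>F. (\<lambda>l. (L z ! l, l)) ` {..<length (L z)})"
  proof
    fix v assume "v \<in> V"
    then have "(v0, v) \<in> R0\<^sup>*" by (simp add: V_def)
    then show "v \<in> insert v0 (\<Union>z\<in>F. (\<lambda>l. (L z ! l, l)) ` {..<length (L z)})"
      by (cases rule: rtrancl.cases) (auto simp: R0_def)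
  qed
  moreover have "finite (insert v0 (\<Union>z\<in>F. (\<lambda>l. (L z ! l, l)) ` {..<length (L z)}))"
    using F(1) by auto
  ultimately have finV: "finite V" by (rule finite_subset)
  have closed: "u \<in> V" if "v \<in> V" "(v, u) \<in> R0" for u v
    using that unfolding V_def by (auto intro: rtrancl_into_rtrancl)
  have v0V: "v0 \<in> V" by (simp add: V_def)
  have to_R: "(v, u) \<in> R\<^sup>*" if "(v, u) \<in> R0\<^sup>*" "v \<in> V" for u v
  proof -
    from that have "(v, u) \<in> R\<^sup>* \<and> u \<in> V"
    proof (induction rule: rtrancl_induct)
      case (step y z)
      then have "z \<in> V" using closed by blast
      then have "(y, z) \<in> R" using step by (simp add: R_def)
      with step \<open>z \<in> V\<close> show ?case by (blast intro: rtrancl_into_rtrancl)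
    qed auto
    then show ?thesis ..
  qed
  have to_v0: "((z, k), v0) \<in> R0\<^sup>*" if "z \<in> F" for z k
    using reach[OF that]
  proof (induction arbitrary: k rule: converse_rtrancl_induct)
    case base
    show ?case using loop by blast
  next
    case (step z y)
    then obtain l where "((z, k), (y, l)) \<in> R0" by (auto simp: R0_def in_set_conv_nth)
    with step.IH show ?case by (meson converse_rtrancl_into_rtrancl)
  qed
  have "mixing_graph V R"
  proof (rule mixing_graph_if_loop)
    show "finite V" "v0 \<in> V" "R \<subseteq> V \<times> V" using finV v0V by (auto simp: R_def)
    show "(v0, v0) \<in> R" using loop[of l0] v0V by (simp add: R_def flip: v0_def)
    fix v assume v: "v \<in> V"
    have "(v, v0) \<in> R0\<^sup>*" using to_v0[of "fst v" "snd v"] F_V[OF v] by simp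
    moreover have "(v0, v) \<in> R0\<^sup>*" using v by (simp add: V_def)
    ultimately show "(v, v0) \<in> R\<^sup>* \<and> (v0, v) \<in> R\<^sup>*" using to_R v v0V by blast
  qed
  moreover have "val (fst v) > 0" if "v \<in> V" for v using F(4) F_V[OF that] by blast
  moreover have "(\<Sum>u\<in>R `` {v}. val (fst u)) = \<alpha> * val (fst v)" if v: "v \<in> V" for v
  proof -
    obtain z k where zk: "v = (z, k)" by (cases v)
    have z: "z \<in> F" using F_V[OF v] zk by simp
    have "R `` {v} = R0 `` {v}" using closed v by (auto simp: R_def)
    also have "\<dots> = (\<lambda>l. (L z ! l, l)) ` {..<length (L z)}"
      using z by (auto simp: zk R0_def)
    finally have "(\<Sum>u\<in>R `` {v}. val (fst u)) = (\<Sum>l<length (L z). val (L z ! l))"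
      by (simp add: sum.reindex inj_on_def)
    also have "\<dots> = sum_list (map val (L z))"
      by (simp add: sum_list_sum_nth atLeast0LessThan)
    also have "\<dots> = \<alpha> * val (fst v)" using Lsum[OF z] zk by simp
    finally show ?thesis .
  qed
  ultimately show thesis by (rule that)
qed

text \<open>Only a renaming of the vertices by natural numbers remains.\<close>

lemma (in mixing_graph) realising_random_substitution:
  fixes r :: "'a \<Rightarrow> real"
  assumes "\<And>a. a \<in> V \<Longrightarrow> (\<Sum>b\<in>R `` {a}. r b) = \<alpha> * r a"
    and "\<And>a. a \<in> V \<Longrightarrow> r a > 0" and "\<alpha> > 0"
  shows "\<exists>(A :: nat set) \<theta>.
           random_substitution A \<theta> \<and> primitive_subst A \<theta> \<and> rs_subshift A \<theta> \<noteq> {} \<and>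
           topologically_mixing (subtopology (full_shift_topology A) (rs_subshift A \<theta>)) shift \<and>
           topological_entropy (rs_subshift A \<theta>) = ln \<alpha>"
proof -
  obtain f :: "'a \<Rightarrow> nat" where f: "inj_on f V"
    using finite_imp_inj_to_nat_seg[OF fin] by blast
  interpret G: mixing_graph "f ` V" "map_prod f f ` R"
    using mixing_graph_inj_image[OF mixing_graph_axioms f] .
  define r' where "r' = r \<circ> inv_into V f"
  have r'f: "r' (f a) = r a" if "a \<in> V" for a using f that by (simp add: r'_def)
  have "topological_entropy G.paths = ln \<alpha>"
  proof (rule G.entropy_paths[of r'])
    fix a assume "a \<in> f ` V"
    then obtain b where b: "b \<in> V" "a = f b" by blast
    have sub: "R `` {b} \<subseteq> V" using edges by auto
    have "(map_prod f f ` R) `` {f b} = f ` (R `` {b})"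
    proof (intro subset_antisym subsetI)
      fix y assume "y \<in> (map_prod f f ` R) `` {f b}"
      then obtain x c where xc: "(x, c) \<in> R" "f x = f b" "y = f c" by auto
      with edges have "x \<in> V" by auto
      with xc inj_onD[OF f] b(1) have "x = b" by blast
      with xc show "y \<in> f ` (R `` {b})" by blast
    qed auto
    then have "(\<Sum>c\<in>(map_prod f f ` R) `` {f b}. r' c) = (\<Sum>c\<in>R `` {b}. r' (f c))"
      using inj_on_subset[OF f sub] by (simp add: sum.reindex)
    also have "\<dots> = (\<Sum>c\<in>R `` {b}. r c)" using sub r'f by (intro sum.cong) auto
    finally show "(\<Sum>c\<in>(map_prod f f ` R) `` {a}. r' c) = \<alpha> * r' a"
      using assms(1) b r'f by simp
  qed (use assms r'f in auto)
  moreover obtain a where "a \<in> f ` V" using nonempty by blast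
  then have "G.paths \<noteq> {}" using G.path_through by blast
  ultimately show ?thesis
    using G.random_substitution_loop_subst G.primitive_loop_subst G.paths_topologically_mixing
    by (intro exI[of _ "f ` V"] exI[of _ G.loop_subst]) (simp add: G.rs_subshift_eq)
qed

theorem corollary27:
  fixes \<alpha> :: real
  assumes "perron_number \<alpha>"
  shows "\<exists>(A :: nat set) \<theta>.
           random_substitution A \<theta> \<and> primitive_subst A \<theta> \<and>
           rs_subshift A \<theta> \<noteq> {} \<and>
           topologically_mixing (subtopology (full_shift_topology A) (rs_subshift A \<theta>)) shift \<and>
           topological_entropy (rs_subshift A \<theta>) = ln \<alpha>"
proof (cases "\<alpha> = 1")
  case True
  \<comment> \<open>The cone construction needs \<open>\<alpha> > 1\<close> for elements to grow; here a single vertex with a loop suffices.\<close>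
  have "mixing_graph {0 :: nat} {(0, 0)}"
    by (rule mixing_graph_if_loop[where ?v0.0 = 0]) simp_all
  then show ?thesis
  proof (rule mixing_graph.realising_random_substitution[where r = "\<lambda>_. 1"])
    fix a :: nat assume "a \<in> {0}"
    then have "{(0, 0)} `` {a} = {0 :: nat}" by auto
    then show "(\<Sum>b::nat\<in>{(0, 0)} `` {a}. 1) = \<alpha> * 1" by (simp only: True) simp
  qed (simp_all add: True)
next
  case False
  with assms have \<alpha>: "\<alpha> > 1" by (simp add: perron_number_def)
  show ?thesis
  proof (rule perron_minimal_polynomial[OF assms])
    fix m assume m: "lead_coeff m = 1" "degree m > 0" "poly (ipoly m) (of_real \<alpha>) = 0"
      "\<And>z. poly (ipoly m) z = 0 \<Longrightarrow> z \<noteq> of_real \<alpha> \<Longrightarrow> cmod z < \<alpha>"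
      "card {z. poly (ipoly m) z = 0} = degree m"
    interpret P: perron_poly m \<alpha>
      by (rule perron_poly.intro[OF m \<alpha>])
    show ?thesis
    proof (rule P.finite_successor_system)
      fix F z0 L assume F: "finite F" "z0 \<in> F" "z0 \<in> set (L z0)" "\<And>z. z \<in> F \<Longrightarrow> P.val z > 0"
        "\<And>z. z \<in> F \<Longrightarrow> set (L z) \<subseteq> F"
        "\<And>z. z \<in> F \<Longrightarrow> sum_list (map P.val (L z)) = \<alpha> * P.val z"
        "\<And>z. z \<in> F \<Longrightarrow> (z, z0) \<in> {(z, y). z \<in> F \<and> y \<in> set (L z)}\<^sup>*"
      show ?thesis
      proof (rule mixing_graph_of_successor_system[of F z0 L P.val \<alpha>, OF F])
        fix V and R :: "((int poly \<times> nat) \<times> int poly \<times> nat) set"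
        assume G: "mixing_graph V R" "\<And>v. v \<in> V \<Longrightarrow> P.val (fst v) > 0"
          "\<And>v. v \<in> V \<Longrightarrow> (\<Sum>u\<in>R `` {v}. P.val (fst u)) = \<alpha> * P.val (fst v)"
        from \<alpha> have "\<alpha> > 0" by simp
        with G show ?thesis
          by (intro mixing_graph.realising_random_substitution[where r = "\<lambda>v. P.val (fst v)"])
      qed
    qed
  qed
qed

end
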